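(* For every positive integer $n$, $$|D_c(n)|=\sum_{N\in I'_e(n)}\ \sum_{k=1}^{n-1}|P(N-k-n+1,\,k-1,\,n-1,\,n-k-1)|,$$ where $I'_e(n)=\{N : 2(n-1)\le N\le n(n-1),\ N \text{ an even integer}\}$. Moreover, there is an algorithm which, given a positive integer $n$, computes $|D_c(n)|$ in time $O(n^5)$ and space $O(n^5)$.
   Context: All graphs are finite, simple (no loops or multiple edges) and undirected. Degree sequences are unordered (i.e. regarded as multisets, written in non-increasing order). $D(n)$ is the set of zero-free degree sequences of length $n$: those sequences $d_1\ge d_2\ge\dots\ge d_n\ge 1$ of positive integers that are the vertex degrees of some graph on $n$ vertices. $D_c(n)$ is the subset of $D(n)$ consisting of the potentially connected sequences, i.e. those that are the degree sequence of at least one connected graph on $n$ vertices. A partition of an integer $N\ge 0$ is a non-increasing sequence of positive integers (parts) with sum $N$ (the empty partition is the only partition of $0$). For a partition $\pi$, $\pi_i$ and $\pi_i'$ denote the number of dots in the $i$-th row and the $i$-th column of its Ferrers diagram (so $\pi_i$ is the $i$-th part and $\pi'$ is the conjugate partition), $d(\pi)$ is the size (number of rows) of its Durfee square, i.e. of the largest upper-left square contained in its Ferrers diagram, and $r_i(\pi)=\pi_i'-\pi_i$ for $1\le i\le d(\pi)$. $P(N,k,l)$ is the set of partitions of $N$ into at most $l$ parts with largest part at most $k$ (empty if $N<0$, $k<0$ or $l<0$). For an integer $s$, $P(N,k,l,s)=\emptyset$ if $s<0$, and if $s\ge 0$, $$P(N,k,l,s)=\Big\{\pi\in P(N,k,l)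 : s+\sum_{i=1}^{j}r_i(\pi)\ge j \text{ for all } 1\le j\le d(\pi)\Big\}.$$ Cost model: time is the number of elementary operations (additions, subtractions and comparisons of integers, array accesses), each of unit cost; space is the number of integers stored. *)

theory Defs
  imports
    "HOL-Library.Multiset"
    "HOL-Library.Landau_Symbols"
    "Graph_Theory.Graph_Theory"
begin

section \<open>Degree sequences\<close>

text \<open>
  A finite simple undirected graph is a finite symmetric loop-free digraph without parallel arcs
  (locale \<open>pair_graph\<close>): the edge \<open>uv\<close> is the pair of arcs \<open>(u, v)\<close>, \<open>(v, u)\<close>, so that
  the degree of a vertex is its out-degree.
  Every finite graph has an isomorphic copy whose vertices are natural numbers.
\<close>

definition is_degree_seq :: "nat pair_pre_digraph \<Rightarrow> nat list \<Rightarrow> bool" where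
  "is_degree_seq G d \<longleftrightarrow>
     sorted_wrt (\<ge>) d \<and> mset d = image_mset (out_degree (with_proj G)) (mset_set (pverts G))"

definition deg_seqs :: "nat \<Rightarrow> nat list set" where
  "deg_seqs n = {d. length d = n \<and> (\<forall>x\<in>set d. 1 \<le> x) \<and>
     (\<exists>G. pair_graph G \<and> card (pverts G) = n \<and> is_degree_seq G d)}"

definition conn_deg_seqs :: "nat \<Rightarrow> nat list set" where
  "conn_deg_seqs n = {d \<in> deg_seqs n.
     \<exists>G. pair_graph G \<and> card (pverts G) = n \<and> connected (with_proj G) \<and> is_degree_seq G d}"

section \<open>Partitions\<close>

definition is_partition :: "nat list \<Rightarrow> bool" where
  "is_partition p \<longleftrightarrow> sorted_wrt (\<ge>) p \<and> (\<forall>x\<in>set p. 0 < x)"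

text \<open>Rows and columns are numbered from 1.\<close>

definition ferrers :: "nat list \<Rightarrow> (nat \<times> nat) set" where
  "ferrers p = {(i, j). 1 \<le> i \<and> i \<le> length p \<and> 1 \<le> j \<and> j \<le> p ! (i - 1)}"

definition row_len :: "nat list \<Rightarrow> nat \<Rightarrow> nat" where
  "row_len p i = card {j. (i, j) \<in> ferrers p}"

definition col_len :: "nat list \<Rightarrow> nat \<Rightarrow> nat" where
  "col_len p j = card {i. (i, j) \<in> ferrers p}"

definition durfee :: "nat list \<Rightarrow> nat" where
  "durfee p = Max {m. {1..m} \<times> {1..m} \<subseteq> ferrers p}"

definition corank :: "nat list \<Rightarrow> nat \<Rightarrow> int" where
  "corank p i = int (col_len p i) - int (row_len p i)"

definition partitions_in :: "int \<Rightarrow> int \<Rightarrow> int \<Rightarrow> nat list set" where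
  "partitions_in N k l =
     (if N < 0 \<or> k < 0 \<or> l < 0 then {}
      else {p. is_partition p \<and> int (sum_list p) = N \<and> int (length p) \<le> l \<and>
               (\<forall>x\<in>set p. int x \<le> k)})"

definition partitions_in_corank :: "int \<Rightarrow> int \<Rightarrow> int \<Rightarrow> int \<Rightarrow> nat list set" where
  "partitions_in_corank N k l s =
     (if s < 0 then {}
      else {p \<in> partitions_in N k l.
              \<forall>j\<in>{1..durfee p}. s + (\<Sum>i=1..j. corank p i) \<ge> int j})"

definition edge_sums :: "nat \<Rightarrow> int set" where
  "edge_sums n = {N. 2 * (int n - 1) \<le> N \<and> N \<le> int n * (int n - 1) \<and> even N}"

section \<open>Algorithms and their cost\<close>

text \<open>
  An algorithm is a while-program over integer variables and integer arrays, with addition,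
  subtraction and comparison as its only operations on integers.
  A memory cell is an array name together with a list of indices; scalar variables are the arrays
  of dimension 0.  Since index lists are written out in the program text, every program uses arrays
  of boundedly many dimensions only.
\<close>

type_synonym cell = "nat \<times> int list"
type_synonym store = "cell \<Rightarrow> int"

datatype exp = Const int | Get nat "exp list" | Add exp exp | Sub exp exp

datatype test = Less exp exp | Equal exp exp

datatype com =
    Skip
  | Put nat "exp list" exp
  | Seq com com
  | If test com com
  | While test com

fun val :: "store \<Rightarrow> exp \<Rightarrow> int" where
  "val \<sigma> (Const c) = c"
| "val \<sigma> (Get a es) = \<sigma> (a, map (val \<sigma>) es)"
| "val \<sigma> (Add e f) = val \<sigma> e + val \<sigma> f"
| "val \<sigma> (Sub e f) = val \<sigma> e - val \<sigma> f"

fun ops :: "exp \<Rightarrow> nat" where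
  "ops (Const c) = 0"
| "ops (Get a es) = 1 + sum_list (map ops es)"
| "ops (Add e f) = 1 + ops e + ops f"
| "ops (Sub e f) = 1 + ops e + ops f"

fun cells :: "store \<Rightarrow> exp \<Rightarrow> cell set" where
  "cells \<sigma> (Const c) = {}"
| "cells \<sigma> (Get a es) = insert (a, map (val \<sigma>) es) (\<Union>e\<in>set es. cells \<sigma> e)"
| "cells \<sigma> (Add e f) = cells \<sigma> e \<union> cells \<sigma> f"
| "cells \<sigma> (Sub e f) = cells \<sigma> e \<union> cells \<sigma> f"

fun test_val :: "store \<Rightarrow> test \<Rightarrow> bool" where
  "test_val \<sigma> (Less e f) \<longleftrightarrow> val \<sigma> e < val \<sigma> f"
| "test_val \<sigma> (Equal e f) \<longleftrightarrow> val \<sigma> e = val \<sigma> f"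

fun test_ops :: "test \<Rightarrow> nat" where
  "test_ops (Less e f) = 1 + ops e + ops f"
| "test_ops (Equal e f) = 1 + ops e + ops f"

fun test_cells :: "store \<Rightarrow> test \<Rightarrow> cell set" where
  "test_cells \<sigma> (Less e f) = cells \<sigma> e \<union> cells \<sigma> f"
| "test_cells \<sigma> (Equal e f) = cells \<sigma> e \<union> cells \<sigma> f"

text \<open>
  \<open>exec c \<sigma> t M \<sigma>'\<close>: started in the store \<open>\<sigma>\<close>, the program \<open>c\<close> terminates in the store \<open>\<sigma>'\<close> after
  \<open>t\<close> elementary operations, and \<open>M\<close> is the set of cells it has read or written on the way.
\<close>

inductive exec :: "com \<Rightarrow> store \<Rightarrow> nat \<Rightarrow> cell set \<Rightarrow> store \<Rightarrow> bool" where
  Skip: "exec Skip \<sigma> 0 {} \<sigma>"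
| Put: "x = (a, map (val \<sigma>) es) \<Longrightarrow>
    exec (Put a es e) \<sigma> (1 + sum_list (map ops es) + ops e)
      (insert x ((\<Union>f\<in>set es. cells \<sigma> f) \<union> cells \<sigma> e)) (\<sigma>(x := val \<sigma> e))"
| Seq: "exec c \<sigma> t M \<sigma>' \<Longrightarrow> exec d \<sigma>' u L \<sigma>'' \<Longrightarrow>
    exec (Seq c d) \<sigma> (t + u) (M \<union> L) \<sigma>''"
| IfTrue: "test_val \<sigma> b \<Longrightarrow> exec c \<sigma> t M \<sigma>' \<Longrightarrow>
    exec (If b c d) \<sigma> (test_ops b + t) (test_cells \<sigma> b \<union> M) \<sigma>'"
| IfFalse: "\<not> test_val \<sigma> b \<Longrightarrow> exec d \<sigma> t M \<sigma>' \<Longrightarrow>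
    exec (If b c d) \<sigma> (test_ops b + t) (test_cells \<sigma> b \<union> M) \<sigma>'"
| WhileFalse: "\<not> test_val \<sigma> b \<Longrightarrow>
    exec (While b c) \<sigma> (test_ops b) (test_cells \<sigma> b) \<sigma>"
| WhileTrue: "test_val \<sigma> b \<Longrightarrow> exec c \<sigma> t M \<sigma>' \<Longrightarrow> exec (While b c) \<sigma>' u L \<sigma>'' \<Longrightarrow>
    exec (While b c) \<sigma> (test_ops b + t + u) (test_cells \<sigma> b \<union> M \<union> L) \<sigma>''"

lemma finite_cells: "finite (cells \<sigma> e)"
  by (induction \<sigma> e rule: cells.induct) auto

lemma exec_finite: "exec c \<sigma> t M \<sigma>' \<Longrightarrow> finite M"
proof (induction rule: exec.induct)
  case (IfTrue \<sigma> b c t M \<sigma>' d)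
  then show ?case by (cases b) (auto simp: finite_cells)
next
  case (IfFalse \<sigma> b d t M \<sigma>' c)
  then show ?case by (cases b) (auto simp: finite_cells)
next
  case (WhileFalse \<sigma> b c)
  then show ?case by (cases b) (auto simp: finite_cells)
next
  case (WhileTrue \<sigma> b c t M \<sigma>' u L \<sigma>'')
  then show ?case by (cases b) (auto simp: finite_cells)
qed (auto simp: finite_cells)

lemma exec_deterministic:
  "exec c \<sigma> t M \<sigma>' \<Longrightarrow> exec c \<sigma> u L \<sigma>'' \<Longrightarrow> u = t \<and> L = M \<and> \<sigma>'' = \<sigma>'"
proof (induction arbitrary: u L \<sigma>'' rule: exec.induct)
  case (Skip \<sigma>)
  then show ?case by (auto elim: exec.cases)
next
  case (Put x a \<sigma> es e)
  from Put.prems show ?case by (cases rule: exec.cases) (use Put.hyps in auto)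
next
  case (Seq c \<sigma> t M \<sigma>' d u' L' \<sigma>2)
  from Seq.prems show ?case by (cases rule: exec.cases) (use Seq.IH in blast)
next
  case (IfTrue \<sigma> b c t M \<sigma>' d)
  from IfTrue.prems show ?case
    by (cases rule: exec.cases) (use IfTrue.hyps IfTrue.IH in blast)+
next
  case (IfFalse \<sigma> b d t M \<sigma>' c)
  from IfFalse.prems show ?case
    by (cases rule: exec.cases) (use IfFalse.hyps IfFalse.IH in blast)+
next
  case (WhileFalse \<sigma> b c)
  from WhileFalse.prems show ?case
    by (cases rule: exec.cases) (use WhileFalse.hyps in blast)+
next
  case (WhileTrue \<sigma> b c t M \<sigma>' u' L' \<sigma>2)
  from WhileTrue.prems show ?case
    by (cases rule: exec.cases) (use WhileTrue.hyps WhileTrue.IH in blast)+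
qed

definition input_store :: "nat \<Rightarrow> store" where
  "input_store n = (\<lambda>_. 0)((0, []) := int n)"

text \<open>
  On every positive input \<open>n\<close>, found in variable 0 while all other cells hold 0, the program leaves
  \<open>f n\<close> in variable 1, using exactly \<open>T n\<close> elementary operations and \<open>S n\<close> memory cells.
\<close>

definition computes :: "com \<Rightarrow> (nat \<Rightarrow> nat) \<Rightarrow> (nat \<Rightarrow> nat) \<Rightarrow> (nat \<Rightarrow> nat) \<Rightarrow> bool" where
  "computes c f T S \<longleftrightarrow>
     (\<forall>n\<ge>1. \<exists>M \<sigma>. exec c (input_store n) (T n) M \<sigma> \<and> card M = S n \<and> \<sigma> (1, []) = int (f n))"

end

theory Submission
  imports Defs
begin

text \<open>
  A zero-free non-increasing sequence \<open>d\<close> of length \<open>n\<close> is a partition, and it turns out to be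
  potentially connected exactly if its sum is even and at least \<open>2 * (n - 1)\<close> and its coranks
  satisfy \<open>r\<^sub>1 + \<dots> + r\<^sub>j \<ge> j\<close> for every \<open>j\<close> up to the Durfee size (\<open>conn_deg_seqs_iff\<close>).
  The corank condition is the family of Erdos-Gallai inequalities in disguise, because
  \<open>r\<^sub>1 + \<dots> + r\<^sub>j\<close> is the sum of all \<open>min (d\<^sub>i) j\<close> minus the sum of the first \<open>j\<close> parts
  (\<open>sum_corank\<close>).  Necessity is double counting, the handshake lemma, and the fact that a connected
  graph has at least \<open>n - 1\<close> edges.

  Sufficiency is by induction on \<open>n\<close>: remove a vertex \<open>v\<close> of minimum degree \<open>t\<close>, lower the \<open>t\<close>
  largest remaining degrees by one, realize the rest by a connected graph and join \<open>v\<close> to those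
  \<open>t\<close> vertices.  Choosing a vertex of minimum degree makes connectedness free of charge: the sum
  drops by \<open>2 * t\<close>, and it stays at least \<open>2 * (n - 2)\<close> since for \<open>t \<ge> 2\<close> all \<open>n\<close> degrees are at
  least \<open>t\<close>.  The work is to show that the Erdos-Gallai inequalities survive
  (\<open>erdos_gallai_remove_min\<close>).  They are stated for arbitrary disjoint vertex sets \<open>A\<close>, \<open>B\<close>, so that
  they are linear in the degrees and no re-sorting is needed.  A most violated pair consists of
  level sets of the degree function, which leaves few cases.

  Deleting the first row and the first column from the diagram of \<open>d\<close> turns the corank condition
  with parameter \<open>s\<close> into the same condition with parameter \<open>s + l - k - 1\<close>, where the first row
  has length \<open>k + 1\<close> and the first column \<open>l + 1\<close> (\<open>corank_ok_hook\<close>).  Applied once, this gives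
  the formula for the number of sequences; applied repeatedly, it gives a recurrence
  (\<open>tail_count_rec\<close>).

  For the algorithm it would be wasteful to tabulate by the exact sum.  Only the parity of the sum
  and a lower bound matter, so the table is indexed by an offset \<open>x\<close> and counts the partitions
  \<open>p\<close> for which \<open>sum_list p + x\<close> is even and nonnegative.  A positive offset can be lowered by 2
  (\<open>tail_count_pos_shift\<close>), so \<open>3 * n\<close> offsets suffice.  With \<open>n\<close> values each of \<open>k\<close> and \<open>l\<close>,
  and \<open>n\<^sup>2\<close> values of \<open>s\<close>, the table has \<open>O(n^5)\<close> entries, each computed in constant time.  The
  space bound is a consequence of the time bound, as every access to a cell costs a unit of time.
\<close>

section \<open>Erdos-Gallai inequalities\<close>

text \<open>
  For the best choice of \<open>B\<close> given \<open>A\<close>, the vertices outside \<open>A\<close> of degree at least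
  \<open>card A\<close>, nonnegativity is the usual Erdos-Gallai inequality with \<open>min (d v) (card A)\<close>.
  Leaving \<open>B\<close> free removes the minimum.
\<close>

definition slack :: "'a set \<Rightarrow> ('a \<Rightarrow> nat) \<Rightarrow> 'a set \<Rightarrow> 'a set \<Rightarrow> int" where
  "slack V d A B = int (card A) * (int (card A) - 1) + int (card A) * int (card B)
     + (\<Sum>v\<in>V - A - B. int (d v)) - (\<Sum>v\<in>A. int (d v))"

definition erdos_gallai :: "'a set \<Rightarrow> ('a \<Rightarrow> nat) \<Rightarrow> bool" where
  "erdos_gallai V d \<longleftrightarrow> (\<forall>A B. A \<subseteq> V \<longrightarrow> B \<subseteq> V \<longrightarrow> A \<inter> B = {} \<longrightarrow> 0 \<le> slack V d A B)"

lemma erdos_gallaiD: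
  "\<lbrakk>erdos_gallai V d; A \<subseteq> V; B \<subseteq> V; A \<inter> B = {}\<rbrakk> \<Longrightarrow> 0 \<le> slack V d A B"
  by (auto simp: erdos_gallai_def)

lemma slack_move:
  assumes "finite V" "A \<subseteq> V" "B \<subseteq> V" "A \<inter> B = {}" "x \<in> A"
  shows "slack V d (A - {x}) (insert x B)
    = slack V d A B + int (d x) - (int (card A) + int (card B) - 1)"
proof -
  have fin: "finite A" "finite B" using assms finite_subset by blast+
  have "card A \<ge> 1" using assms fin by (auto simp: Suc_le_eq card_gt_0_iff)
  moreover have "V - (A - {x}) - insert x B = V - A - B" using assms by auto
  moreover have "(\<Sum>v\<in>A. int (d v)) = int (d x) + (\<Sum>v\<in>A - {x}. int (d v))"
    using fin assms by (simp add: sum.remove)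
  ultimately show ?thesis
    using assms fin by (auto simp: slack_def card_insert_if of_nat_diff algebra_simps)
qed

lemma slack_drop:
  assumes "finite V" "A \<subseteq> V" "B \<subseteq> V" "A \<inter> B = {}" "x \<in> B"
  shows "slack V d A (B - {x}) = slack V d A B + int (d x) - int (card A)"
proof -
  have fin: "finite A" "finite B" using assms finite_subset by blast+
  have "card B \<ge> 1" using assms fin by (auto simp: Suc_le_eq card_gt_0_iff)
  moreover have "V - A - (B - {x}) = insert x (V - A - B)" using assms by auto
  ultimately show ?thesis
    using assms fin by (auto simp: slack_def of_nat_diff algebra_simps)
qed

text \<open>
  Among the pairs of least slack take one with \<open>B\<close> as large as possible.  No single vertex can be
  moved between \<open>A\<close>, \<open>B\<close> and the rest to decrease the slack, and moves into \<open>B\<close> must even increase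
  it.  This pins down all three sets as level sets of \<open>d\<close>.
\<close>

lemma slack_minimiser:
  assumes "finite V" "\<not> erdos_gallai V d"
  obtains A B where "A \<subseteq> V" "B \<subseteq> V" "A \<inter> B = {}" "slack V d A B < 0"
    "\<And>x. x \<in> A \<Longrightarrow> int (d x) \<ge> int (card A) + int (card B)"
    "\<And>x. x \<in> B \<Longrightarrow> int (card A) \<le> int (d x) \<and> int (d x) < int (card A) + int (card B)"
    "\<And>x. x \<in> V - A - B \<Longrightarrow> int (d x) < int (card A)"
proof -
  let ?S = "{(A, B). A \<subseteq> V \<and> B \<subseteq> V \<and> A \<inter> B = {}}"
  let ?f = "\<lambda>(A, B). slack V d A B"
  have "finite ?S"
    by (rule finite_subset[of _ "Pow V \<times> Pow V"]) (use assms in auto)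
  have "?S \<noteq> {}" by auto
  have "Min (?f ` ?S) \<in> ?f ` ?S"
    by (intro Min_in finite_imageI) (use \<open>finite ?S\<close> \<open>?S \<noteq> {}\<close> in auto)
  then obtain p where pS: "p \<in> ?S" and pf: "?f p = Min (?f ` ?S)" by (metis (no_types, lifting) imageE)
  have p: "?f p \<le> ?f q" if "q \<in> ?S" for q
    unfolding pf by (intro Min_le finite_imageI imageI \<open>finite ?S\<close> that)
  let ?M = "{q \<in> ?S. ?f q = ?f p}"
  have "finite ?M" "?M \<noteq> {}" using \<open>finite ?S\<close> pS by auto
  then have "Max ((card \<circ> snd) ` ?M) \<in> (card \<circ> snd) ` ?M" by (intro Max_in) auto
  then obtain q where qM: "q \<in> ?M" and qf: "Max ((card \<circ> snd) ` ?M) = (card \<circ> snd) q"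
    by (rule imageE)
  have q: "card (snd r) \<le> card (snd q)" if "r \<in> ?M" for r
    using Max_ge[OF finite_imageI[OF \<open>finite ?M\<close>] imageI[OF that], of "card \<circ> snd"]
    unfolding qf by simp
  obtain A B where [simp]: "q = (A, B)" by (cases q)
  have AB: "A \<subseteq> V" "B \<subseteq> V" "A \<inter> B = {}" "slack V d A B = ?f p" using qM by auto
  have min: "slack V d A B \<le> slack V d A' B'"
    "slack V d A' B' = slack V d A B \<Longrightarrow> card B' \<le> card B"
    if "A' \<subseteq> V" "B' \<subseteq> V" "A' \<inter> B' = {}" for A' B'
    using p[of "(A', B')"] q[of "(A', B')"] that AB by auto
  have fin: "finite A" "finite B" using AB assms finite_subset by blast+
  show thesis
  proof (rule that[OF AB(1-3)])
    from assms(2) obtain A' B' where "A' \<subseteq> V" "B' \<subseteq> V" "A' \<inter> B' = {}" "slack V d A' B' < 0"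
      by (auto simp: erdos_gallai_def not_le)
    with min(1)[of A' B'] show "slack V d A B < 0" by auto
  next
    fix x assume x: "x \<in> A"
    have "x \<notin> B" using x AB by auto
    have *: "A - {x} \<subseteq> V" "insert x B \<subseteq> V" "(A - {x}) \<inter> insert x B = {}" using x AB by auto
    have "slack V d (A - {x}) (insert x B) \<noteq> slack V d A B"
      using min(2)[OF *] fin \<open>x \<notin> B\<close> by auto
    then show "int (d x) \<ge> int (card A) + int (card B)"
      using min(1)[OF *] slack_move[OF assms(1) AB(1-3) x, of d] by linarith
  next
    fix x assume x: "x \<in> B"
    then have xA: "x \<notin> A" using AB by auto
    have *: "A \<subseteq> V" "B - {x} \<subseteq> V" "A \<inter> (B - {x}) = {}" using x AB by auto
    have **: "insert x A \<subseteq> V" "B - {x} \<subseteq> V" "insert x A \<inter> (B - {x}) = {}" using x AB by auto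
    have "insert x A - {x} = A" "insert x (B - {x}) = B" using x xA by auto
    then have "slack V d A B = slack V d (insert x A) (B - {x}) + int (d x)
        - (int (card (insert x A)) + int (card (B - {x})) - 1)"
      using slack_move[OF assms(1) **, of x d] by auto
    moreover have "card (insert x A) = card A + 1" "card B = card (B - {x}) + 1"
      using fin xA card_Suc_Diff1[OF fin(2) x] by auto
    ultimately show "int (card A) \<le> int (d x) \<and> int (d x) < int (card A) + int (card B)"
      using min(1)[OF *] min(1)[OF **] slack_drop[OF assms(1) AB(1-3) x, of d] by linarith
  next
    fix x assume x: "x \<in> V - A - B"
    have *: "A \<subseteq> V" "insert x B \<subseteq> V" "A \<inter> insert x B = {}" using x AB by auto
    have "insert x B - {x} = B" using x by auto
    then have "slack V d A B = slack V d A (insert x B) + int (d x) - int (card A)"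
      using slack_drop[OF assms(1) *, of x d] by auto
    moreover have "slack V d A (insert x B) \<noteq> slack V d A B"
      using min(2)[OF *] fin x by auto
    ultimately show "int (d x) < int (card A)"
      using min(1)[OF *] by linarith
  qed
qed

text \<open>
  Suppose the smaller instance is violated, and take a violating pair of level sets \<open>A\<close>, \<open>B\<close>
  with complement \<open>C\<close>.  If \<open>T \<subseteq> A\<close>, the inequality for \<open>d\<close> with \<open>v\<close> added to \<open>C\<close> contradicts
  this; if \<open>A \<subseteq> T\<close>, then minimality of \<open>d v\<close> keeps \<open>T\<close> away from \<open>C\<close>, and the inequality with
  \<open>v\<close> added to \<open>B\<close> does.  Otherwise \<open>A - T\<close> and \<open>T - A\<close> are nonempty, and comparing the level sets
  with the choice of \<open>T\<close> shows that \<open>d\<close> has one and the same value \<open>card A + card B\<close> on both.  If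
  \<open>B\<close> is nonempty, moving \<open>T - A\<close> into \<open>A\<close> gives the contradiction.  If it is empty, moving
  \<open>A - T\<close> and \<open>T - A\<close> into \<open>B\<close> shows only that the slack is at least \<open>-1\<close>; here the evenness of
  the sum is indispensable, as for the degrees \<open>1, 1, 1\<close>.
\<close>

lemma erdos_gallai_remove_min:
  fixes d :: "'a \<Rightarrow> nat"
  assumes "finite V" "v \<in> V" and min: "\<And>u. u \<in> V \<Longrightarrow> d v \<le> d u"
    and T: "T \<subseteq> V - {v}" "card T = d v" "\<And>x y. x \<in> T \<Longrightarrow> y \<in> V - {v} - T \<Longrightarrow> d y \<le> d x"
    and eg: "erdos_gallai V d" and ev: "even (sum d V)"
  defines "d' \<equiv> \<lambda>x. if x \<in> T then d x - 1 else d x"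
  shows "erdos_gallai (V - {v}) d'"
proof (rule ccontr)
  define W where "W = V - {v}"
  assume "\<not> erdos_gallai (V - {v}) d'"
  then have "\<not> erdos_gallai W d'" by (simp add: W_def)
  have "finite W" using assms by (simp add: W_def)
  obtain A B where AB: "A \<subseteq> W" "B \<subseteq> W" "A \<inter> B = {}" and neg: "slack W d' A B < 0"
    and hA: "\<And>x. x \<in> A \<Longrightarrow> int (d' x) \<ge> int (card A) + int (card B)"
    and hB: "\<And>x. x \<in> B \<Longrightarrow> int (card A) \<le> int (d' x) \<and> int (d' x) < int (card A) + int (card B)"
    and hC: "\<And>x. x \<in> W - A - B \<Longrightarrow> int (d' x) < int (card A)"
    using slack_minimiser[OF \<open>finite W\<close> \<open>\<not> erdos_gallai W d'\<close>] by metis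
  define C where "C = W - A - B"
  have fin: "finite A" "finite B" "finite C" "finite T"
    using AB \<open>finite W\<close> T(1) finite_subset unfolding C_def W_def by blast+
  have CW: "C \<subseteq> W" and disj: "A \<inter> C = {}" "B \<inter> C = {}" and W: "W = A \<union> B \<union> C"
    using AB by (auto simp: C_def)
  have TW: "T \<subseteq> W" using T(1) by (simp add: W_def)
  have vW: "v \<notin> W" and V: "V = insert v W" using assms(2) by (auto simp: W_def)
  define a b t where "a = int (card A)" and "b = int (card B)" and "t = int (d v)"
  define D where "D = (\<lambda>S. \<Sum>x\<in>S. int (d x))"
  have ab0: "a \<ge> 0" "b \<ge> 0" by (auto simp: a_def b_def)
  have tT: "t = int (card T)" using T(2) by (simp add: t_def)
  have pos: "d x \<ge> 1" if "x \<in> T" for x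
  proof -
    have "d v \<ge> 1" using that fin T(2) by (metis One_nat_def Suc_leI card_gt_0_iff empty_iff)
    with min[of x] that T(1) show ?thesis by auto
  qed
  have d'T: "int (d' x) = int (d x) - 1" if "x \<in> T" for x using pos[OF that] that by (simp add: d'_def)
  have d'N: "d' x = d x" if "x \<notin> T" for x using that by (simp add: d'_def)
  have sum_d': "(\<Sum>x\<in>S. int (d' x)) = D S - int (card (S \<inter> T))" if "finite S" for S
  proof -
    have "(\<Sum>x\<in>S. int (d' x)) = (\<Sum>x\<in>S. int (d x) - (if x \<in> T then 1 else 0))"
      by (rule sum.cong) (auto simp: d'T d'N)
    also have "\<dots> = D S - int (card (S \<inter> T))"
      using that by (simp add: D_def sum_subtractf sum.If_cases Collect_conj_eq flip: Int_def)
    finally show ?thesis .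
  qed
  have slack': "slack W d' A B = a*(a-1) + a*b + D C - int (card (C \<inter> T)) - D A + int (card (A \<inter> T))"
    using fin by (simp add: slack_def sum_d' a_def b_def flip: C_def)
  have DU: "D (X \<union> Y) = D X + D Y" if "finite X" "finite Y" "X \<inter> Y = {}" for X Y
    using that by (simp add: D_def sum.union_disjoint)
  have cU: "int (card (X \<union> Y)) = int (card X) + int (card Y)" if "finite X" "finite Y" "X \<inter> Y = {}" for X Y
    using that by (simp add: card_Un_disjoint)
  have eg': "D X \<le> int (card X) * (int (card X) - 1) + int (card X) * int (card Y) + D (V - X - Y)"
    if "X \<subseteq> V" "Y \<subseteq> V" "X \<inter> Y = {}" for X Y
    using erdos_gallaiD[OF eg that] by (simp add: slack_def D_def)
  have vB: "D A \<le> a*(a-1) + a*(b+1) + D C"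
  proof -
    have "V - A - insert v B = C" using AB vW V by (auto simp: C_def)
    moreover have "v \<notin> B" using AB vW by auto
    ultimately show ?thesis
      using eg'[of A "insert v B"] AB vW V fin by (auto simp: a_def b_def algebra_simps)
  qed
  have vC: "D A \<le> a*(a-1) + a*b + D C + t"
  proof -
    have "V - A - B = insert v C" using AB vW V by (auto simp: C_def)
    moreover have "v \<notin> C" using vW by (auto simp: C_def)
    ultimately show ?thesis
      using eg'[of A "B"] AB V fin by (simp add: a_def b_def t_def D_def subset_insertI2)
  qed
  show False
  proof (cases "T \<subseteq> A")
    case True
    then have "A \<inter> T = T" "C \<inter> T = {}" using disj by auto
    then show False using vC slack' neg tT by simp
  next
    case notTA: False
    show False
    proof (cases "A \<subseteq> T")
      case True
      have "C \<inter> T = {}"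
      proof (rule ccontr)
        assume "C \<inter> T \<noteq> {}"
        then obtain c where c: "c \<in> C" "c \<in> T" by auto
        have "t \<le> int (d c)" using min[of c] c TW V by (auto simp: t_def)
        then have "t \<le> a" using hC[of c] c d'T[of c] by (auto simp: C_def a_def)
        then have "card T \<le> card A" using tT a_def by simp
        then have "A = T" using True fin by (simp add: card_seteq)
        then show False using notTA by auto
      qed
      moreover have "A \<inter> T = A" using True by auto
      ultimately show False using vB slack' neg by (simp add: a_def algebra_simps)
    next
      case False
      define U N X where "U = A \<inter> T" and "N = A - T" and "X = T - A"
      define u q p where "u = int (card U)" and "q = int (card N)" and "p = int (card X)"
      have finU: "finite U" "finite N" "finite X" using fin by (auto simp: U_def N_def X_def)
      have "N \<noteq> {}" "X \<noteq> {}" using False notTA by (auto simp: N_def X_def)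
      then have pq: "p \<ge> 1" "q \<ge> 1" using finU by (auto simp: p_def q_def Suc_le_eq card_gt_0_iff)
      have hNX: "int (d y) = a + b \<and> int (d x) = a + b" if "y \<in> N" "x \<in> X" for x y
      proof -
        have "d y \<le> d x" using T(3)[of x y] that AB by (auto simp: N_def X_def W_def)
        moreover have "int (d y) \<ge> a + b" using hA[of y] that d'N[of y] by (auto simp: N_def a_def b_def)
        moreover have "int (d x) - 1 < a + b"
        proof (cases "x \<in> B")
          case True then show ?thesis using hB[of x] that d'T[of x] by (auto simp: X_def a_def b_def)
        next
          case False
          then have "x \<in> W - A - B" using that TW by (auto simp: X_def)
          then show ?thesis using hC[of x] that d'T[of x] ab0 by (auto simp: X_def a_def b_def)
        qed
        ultimately show ?thesis by linarith
      qed
      then have hN: "\<And>y. y \<in> N \<Longrightarrow> int (d y) = a + b" and hX: "\<And>x. x \<in> X \<Longrightarrow> int (d x) = a + b"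
        using \<open>N \<noteq> {}\<close> \<open>X \<noteq> {}\<close> by blast+
      have DN: "D N = q * (a + b)" and DX: "D X = p * (a + b)"
            using hN hX unfolding D_def q_def p_def by (simp_all cong: sum.cong)
      have A: "A = U \<union> N" "U \<inter> N = {}" and TUX: "T = U \<union> X" "U \<inter> X = {}"
        by (auto simp: U_def N_def X_def)
      have auq: "a = u + q" using cU[OF finU(1,2) A(2)] A(1) by (simp add: a_def u_def q_def)
      have tup: "t = u + p" using cU[OF finU(1,3) TUX(2)] TUX(1) tT by (simp add: u_def p_def)
      have DA: "D A = D U + D N" using DU[OF finU(1,2) A(2)] A(1) by simp
      have AT: "int (card (A \<inter> T)) = u" by (simp add: u_def U_def)
      show False
      proof (cases "b = 0")
        case False
        have XB: "X \<subseteq> B"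
        proof
          fix x assume x: "x \<in> X"
          then have "int (d' x) \<ge> a" using hX[OF x] d'T[of x] False ab0 by (auto simp: X_def)
          then show "x \<in> B" using hC[of x] x TW by (auto simp: X_def a_def)
        qed
        then have "C \<inter> T = {}" using disj TUX A by auto
        have "V - (A \<union> X) - (B - X) = insert v C"
          using XB vW V W AB disj by auto
        moreover have "v \<notin> C" using CW vW by auto
        moreover have "int (card (A \<union> X)) = a + p" "D (A \<union> X) = D A + D X"
          using cU[of A X] DU[of A X] fin finU by (auto simp: X_def a_def p_def)
        moreover have "int (card (B - X)) = b - p"
          using XB finU fin card_mono[OF fin(2) XB] by (simp add: card_Diff_subset b_def p_def of_nat_diff)
        moreover have "D (insert v C) = t + D C" using \<open>v \<notin> C\<close> fin by (simp add: D_def t_def)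
        moreover have "A \<union> X \<subseteq> V" "B - X \<subseteq> V" "(A \<union> X) \<inter> (B - X) = {}"
          using AB V XB by auto
        ultimately have "D A + D X \<le> (a+p)*(a+p-1) + (a+p)*(b-p) + t + D C"
          using eg'[of "A \<union> X" "B - X"] by simp
        then show False
          using neg slack' AT \<open>C \<inter> T = {}\<close> DX tup by (simp add: algebra_simps)
      next
        case True
        then have "B = {}" using fin by (simp add: b_def)
        then have WAC: "W = A \<union> C" using W by auto
        then have XC: "X \<subseteq> C" using TW by (auto simp: X_def)
        have CT: "C \<inter> T = X" using WAC XC disj by (auto simp: X_def)
        define L where "L = C - X"
        have "C = X \<union> L" "X \<inter> L = {}" "finite L" using XC fin by (auto simp: L_def)
        then have DC: "D C = D X + D L" using DU finU by metis
        have "V - U - insert v (N \<union> X) = L"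
          using V WAC A XC vW disj by (auto simp: L_def)
        moreover have "int (card (insert v (N \<union> X))) = q + p + 1"
        proof -
          have "v \<notin> N \<union> X" using vW A AB XC CW by auto
          moreover have "N \<inter> X = {}" by (auto simp: N_def X_def)
          ultimately show ?thesis using finU cU[of N X] by (simp add: q_def p_def)
        qed
        moreover have "U \<subseteq> V" "insert v (N \<union> X) \<subseteq> V" "U \<inter> insert v (N \<union> X) = {}"
          using V vW A AB XC CW disj by auto
        ultimately have "D U \<le> u*(u-1) + u*(q+p+1) + D L" using eg'[of U "insert v (N \<union> X)"]
          by (simp add: u_def)
        then have "slack W d' A B \<ge> (q-1)*(p-1) - 1"
          unfolding slack' AT CT DA DC DN DX True auq
          by (simp add: algebra_simps flip: p_def)
        moreover have "(q-1)*(p-1) \<ge> 0" using pq by simp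
        ultimately have "slack W d' A B = -1" using neg by linarith
        moreover have "even (slack W d' A B)"
        proof -
          have "D V = D A + D C + t"
            using V WAC vW fin DU[OF fin(1,3) disj(1)] by (simp add: D_def t_def)
          moreover have "D V = int (sum d V)" by (simp add: D_def)
          ultimately have "even (D A + D C + t)" using ev by (metis even_of_nat)
          moreover have "slack W d' A B = a*(a-1) + (D A + D C + t) - 2 * D A - 2 * p"
            unfolding slack' AT CT True tup by (simp flip: p_def)
          ultimately show ?thesis by (auto simp: even_add even_diff)
        qed
        ultimately show False by simp
      qed
    qed
  qed
qed

section \<open>Connected realizations\<close>

definition realizes :: "'a set \<Rightarrow> ('a \<times> 'a) set \<Rightarrow> ('a \<Rightarrow> nat) \<Rightarrow> bool" where
  "realizes V E d \<longleftrightarrow> E \<subseteq> V \<times> V \<and> sym E \<and> irrefl E \<and> (\<forall>v\<in>V. card (E `` {v}) = d v)"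

lemma exists_largest:
  fixes d :: "'a \<Rightarrow> nat"
  assumes "finite W" "t \<le> card W"
  shows "\<exists>T\<subseteq>W. card T = t \<and> (\<forall>x\<in>T. \<forall>y\<in>W - T. d y \<le> d x)"
  using assms(2)
proof (induction t)
  case 0
  then show ?case by (intro exI[of _ "{}"]) auto
next
  case (Suc t)
  then obtain T where T: "T \<subseteq> W" "card T = t" "\<forall>x\<in>T. \<forall>y\<in>W - T. d y \<le> d x" by auto
  have fT: "finite T" using T assms finite_subset by auto
  have "W - T \<noteq> {}" using T Suc.prems by auto
  then obtain x where x: "x \<in> W - T" "\<forall>y\<in>W - T. d y \<le> d x"
    using Max_in[of "d ` (W - T)"] Max_ge[of "d ` (W - T)"] assms(1)
    by (metis (no_types, lifting) finite_Diff finite_imageI imageE imageI image_is_empty)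
  then show ?case
    using T fT by (intro exI[of _ "insert x T"]) auto
qed

text \<open>
  Removing a vertex of minimum degree preserves all hypotheses.  For minimum degree 1 with at least
  three vertices, the bound on the sum forces a degree of at least 2, so the neighbour chosen for the
  leaf keeps a positive degree.
\<close>

lemma connected_realization:
  assumes "finite V" "V \<noteq> {}" "erdos_gallai V d" "even (sum d V)" "2 * (card V - 1) \<le> sum d V"
    and "2 \<le> card V \<Longrightarrow> \<forall>v\<in>V. 1 \<le> d v"
  shows "\<exists>E. realizes V E d \<and> V \<times> V \<subseteq> E\<^sup>*"
  using assms
proof (induction "card V" arbitrary: V d rule: less_induct)
  case less
  note eg = erdos_gallaiD[OF less.prems(3)]
  have fV: "finite V" by fact
  obtain v where v: "v \<in> V" "\<And>u. u \<in> V \<Longrightarrow> d v \<le> d u"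
    using Min_in[of "d ` V"] Min_le[of "d ` V"] less.prems(1,2)
    by (metis (no_types, lifting) finite_imageI imageE imageI image_is_empty)
  define W where "W = V - {v}"
  have W: "finite W" "V = insert v W" "v \<notin> W" using fV v by (auto simp: W_def)
  have cV: "card V = card W + 1" using W by simp
  have t: "d v \<le> card W"
    using eg[of "{v}" W] W by (auto simp: slack_def)
  obtain T where T: "T \<subseteq> W" "card T = d v" "\<And>x y. x \<in> T \<Longrightarrow> y \<in> W - T \<Longrightarrow> d y \<le> d x"
    using exists_largest[OF W(1) t, of d] by blast
  have fT: "finite T" using T W finite_subset by blast
  show ?case
  proof (cases "W = {}")
    case True
    then have "realizes V {} d" using W t by (auto simp: realizes_def sym_def irrefl_def)
    then show ?thesis using True W by (intro exI[of _ "{}"]) auto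
  next
    case False
    define d' where "d' = (\<lambda>x. if x \<in> T then d x - 1 else d x)"
    have d1: "d u \<ge> 1" if "u \<in> V" for u
    proof -
      have "card W \<ge> 1" using False W by (simp add: Suc_le_eq card_gt_0_iff)
      then show ?thesis using less.prems(6) that cV by auto
    qed
    have dd': "d x = d' x + (if x \<in> T then 1 else 0)" if "x \<in> W" for x
      using d1[of x] that W by (auto simp: d'_def)
    have "sum d W = sum d' W + (\<Sum>x\<in>W. if x \<in> T then 1 else 0)"
      using dd' by (simp add: sum.distrib)
    also have "(\<Sum>x\<in>W. if x \<in> T then 1 else 0) = card T"
      using W T by (simp add: Int_absorb1 flip: sum.inter_restrict)
    finally have sumW: "sum d V = sum d' W + 2 * d v" using W T by simp
    have eg': "erdos_gallai W d'"
      unfolding d'_def W_def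
      by (rule erdos_gallai_remove_min)
         (use fV v T less.prems in \<open>auto simp: W_def\<close>)
    have "\<forall>x\<in>W. 1 \<le> d' x" if "2 \<le> card W"
    proof (cases "2 \<le> d v")
      case True
      then have "2 \<le> d x" if "x \<in> W" for x using v(2)[of x] that W by auto
      then show ?thesis by (force simp: d'_def)
    next
      case False
      then have dv: "d v = 1" using d1[OF v(1)] by simp
      then obtain x where x: "T = {x}" using T(2) card_1_singletonE by metis
      have "d x \<ge> 2"
      proof (rule ccontr)
        assume "\<not> d x \<ge> 2"
        then have "d y \<le> 1" if "y \<in> V" for y using that T(3)[of x y] x W dv by force
        then have "sum d V \<le> card V" using sum_bounded_above[of V d 1] by simp
        then show False using less.prems(5) cV that by simp
      qed
      then show ?thesis using x d1 W by (auto simp: d'_def)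
    qed
    moreover have "2 * (card W - 1) \<le> sum d' W"
    proof (cases "2 \<le> d v")
      case True
      have "card W * d v \<le> sum d W" using v(2) W by (intro sum_bounded_below[of W "d v" d, simplified]) auto
      moreover have "sum d W = sum d' W + d v" using sumW W by simp
      moreover have "card W * d v = (card W - 1) * d v + d v"
        using t True by (cases "card W") auto
      moreover have "(card W - 1) * 2 \<le> (card W - 1) * d v" using True by simp
      ultimately show ?thesis by linarith
    next
      case False
      then have "d v = 1" using d1[OF v(1)] by simp
      then show ?thesis using less.prems(5) sumW cV by simp
    qed
    moreover have "even (sum d' W)" using less.prems(4) sumW by simp
    ultimately obtain E' where E': "realizes W E' d'" "W \<times> W \<subseteq> E'\<^sup>*"
      using less.hyps[of W d'] cV W False eg' by auto
    define E where "E = E' \<union> {v} \<times> T \<union> T \<times> {v}"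
    have E'W: "E' \<subseteq> W \<times> W" using E' by (simp add: realizes_def)
    have "card (E `` {u}) = d u" if u: "u \<in> V" for u
    proof (cases "u = v")
      case True
      then have "E `` {u} = T" using E'W W T by (auto simp: E_def)
      then show ?thesis using True T by simp
    next
      case False
      then have uW: "u \<in> W" using u W by simp
      have fin: "finite (E' `` {u})" by (rule finite_subset[OF _ W(1)]) (use E'W in auto)
      have "v \<notin> E' `` {u}" using E'W W by auto
      moreover have "E `` {u} = (if u \<in> T then insert v (E' `` {u}) else E' `` {u})"
        using False by (auto simp: E_def)
      moreover have "card (E' `` {u}) = d' u" using E' uW by (simp add: realizes_def)
      ultimately show ?thesis using fin dd'[OF uW] by auto
    qed
    moreover have "E \<subseteq> V \<times> V" using E'W W T by (auto simp: E_def)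
    moreover have "sym E" using E' by (auto simp: realizes_def E_def sym_def)
    moreover have "irrefl E" using E' W T by (auto simp: realizes_def E_def irrefl_def)
    ultimately have "realizes V E d" by (simp add: realizes_def)
    moreover have "V \<times> V \<subseteq> E\<^sup>*"
    proof -
      have "T \<noteq> {}" using T d1[OF v(1)] by auto
      then obtain x where x: "x \<in> T" by auto
      then have vx: "(v, x) \<in> E\<^sup>*" "(x, v) \<in> E\<^sup>*" by (auto simp: E_def)
      have WW: "(a, b) \<in> E\<^sup>*" if "a \<in> W" "b \<in> W" for a b
      proof -
        have "E' \<subseteq> E" by (auto simp: E_def)
        then show ?thesis using that E'(2) rtrancl_mono[of E' E] by blast
      qed
      have "x \<in> W" using x T by blast
      then have ax: "(a, x) \<in> E\<^sup>*" "(x, a) \<in> E\<^sup>*" if "a \<in> V" for a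
        using that vx WW unfolding W(2) by blast+
      show ?thesis
      proof (rule subrelI)
        fix a b assume "(a, b) \<in> V \<times> V"
        then show "(a, b) \<in> E\<^sup>*" using rtrancl_trans[OF ax(1) ax(2), of a b] by simp
      qed
    qed
    ultimately show ?thesis by blast
  qed
qed

section \<open>Necessary conditions\<close>

text \<open>
  Count the arcs that start in \<open>A\<close> by their end \<open>w\<close>: there are at most \<open>card A\<close> and at most
  \<open>d w\<close> of them, and at most \<open>card A - 1\<close> if \<open>w\<close> itself lies in \<open>A\<close>.
\<close>

lemma realizes_erdos_gallai:
  assumes "finite V" "realizes V E d" "A \<subseteq> V" and large: "\<And>v. v \<in> A \<Longrightarrow> card A \<le> d v"
  shows "sum d A + card A \<le> (\<Sum>v\<in>V. min (d v) (card A))"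
proof -
  have E: "E \<subseteq> V \<times> V" "sym E" "irrefl E" "\<And>v. v \<in> V \<Longrightarrow> card (E `` {v}) = d v"
    using assms(2) by (auto simp: realizes_def)
  have fA: "finite A" using assms finite_subset by auto
  let ?c = "\<lambda>v w. if (v, w) \<in> E then 1 else 0 :: nat"
  have deg: "d v = (\<Sum>w\<in>V. ?c v w)" if "v \<in> V" for v
  proof -
    have "E `` {v} = {w \<in> V. (v, w) \<in> E}" using E by auto
    then show ?thesis using E(4)[OF that] assms(1) by (simp add: sum.If_cases Int_def)
  qed
  have "sum d A = (\<Sum>v\<in>A. \<Sum>w\<in>V. ?c v w)" using deg assms(3) by (intro sum.cong) auto
  also have "\<dots> = (\<Sum>w\<in>V. \<Sum>v\<in>A. ?c v w)" by (rule sum.swap)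
  finally have "sum d A + card A = (\<Sum>w\<in>V. (\<Sum>v\<in>A. ?c v w) + (if w \<in> A then 1 else 0))"
    using assms by (simp add: sum.distrib Int_absorb1 flip: sum.inter_restrict)
  also have "\<dots> \<le> (\<Sum>v\<in>V. min (d v) (card A))"
  proof (rule sum_mono)
    fix w assume w: "w \<in> V"
    have eq: "(\<Sum>v\<in>A. ?c v w) = card {v \<in> A. (v, w) \<in> E}" using fA by (simp add: sum.If_cases Int_def)
    have "{v \<in> A. (v, w) \<in> E} \<subseteq> E `` {w}" using E(2) by (auto simp: sym_def)
    moreover have "finite (E `` {w})" by (rule finite_subset[OF _ assms(1)]) (use E(1) in auto)
    ultimately have 1: "card {v \<in> A. (v, w) \<in> E} \<le> d w" using E(4)[OF w] card_mono by metis
    show "(\<Sum>v\<in>A. ?c v w) + (if w \<in> A then 1 else 0) \<le> min (d w) (card A)"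
    proof (cases "w \<in> A")
      case True
      have "{v \<in> A. (v, w) \<in> E} \<subseteq> A - {w}" using E(3) by (auto simp: irrefl_def)
      then have "card {v \<in> A. (v, w) \<in> E} \<le> card A - 1"
        using card_mono[of "A - {w}"] fA True by auto
      moreover have "card A \<ge> 1" using True fA by (auto simp: Suc_le_eq card_gt_0_iff)
      ultimately show ?thesis using True eq large[OF True] by simp
    next
      case False
      have "card {v \<in> A. (v, w) \<in> E} \<le> card A" using fA by (intro card_mono) auto
      then show ?thesis using False eq 1 by simp
    qed
  qed
  finally show ?thesis .
qed

lemma realizes_sum: "finite V \<Longrightarrow> realizes V E d \<Longrightarrow> sum d V = card E"
proof -
  assume V: "finite V" and r: "realizes V E d"
  have "E = (SIGMA v:V. E `` {v})" using r by (auto simp: realizes_def)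
  moreover have "finite (E `` {v})" for v
    by (rule finite_subset[OF _ V]) (use r in \<open>auto simp: realizes_def\<close>)
  ultimately have "card E = (\<Sum>v\<in>V. card (E `` {v}))" using V by (metis card_SigmaI)
  then show "sum d V = card E" using r by (simp add: realizes_def)
qed

lemma realizes_even:
  fixes E :: "('a::linorder \<times> 'a) set"
  assumes "finite V" "realizes V E d"
  shows "even (sum d V)"
proof -
  have E: "E \<subseteq> V \<times> V" "sym E" "irrefl E" using assms(2) by (auto simp: realizes_def)
  define F where "F = {(u, v). (u, v) \<in> E \<and> u < v}"
  have fF: "finite F" by (rule finite_subset[of _ "V \<times> V"]) (use E assms in \<open>auto simp: F_def\<close>)
  have "(u, w) \<in> E \<longleftrightarrow> (u, w) \<in> F \<union> F\<inverse>" for u w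
    using E(2,3) by (cases u w rule: linorder_cases) (auto simp: F_def sym_def irrefl_def)
  then have "E = F \<union> F\<inverse>" by (auto simp del: Un_iff)
  moreover have "F \<inter> F\<inverse> = {}" by (auto simp: F_def)
  ultimately have "card E = card F + card (F\<inverse>)"
    using fF card_Un_disjoint[of F "F\<inverse>"] by simp
  then show ?thesis using realizes_sum[OF assms] by simp
qed

text \<open>
  Every vertex but a root has a neighbour closer to the root.  The edges to these neighbours are
  pairwise different, and their two orientations are different arcs.
\<close>

lemma realizes_connected_sum:
  assumes "finite V" "realizes V E d" and conn: "V \<times> V \<subseteq> E\<^sup>*"
  shows "2 * (card V - 1) \<le> sum d V"
proof (cases "V = {}")
  case False
  then obtain r where r: "r \<in> V" by auto
  have E: "E \<subseteq> V \<times> V" "sym E" using assms(2) by (auto simp: realizes_def)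
  have fE: "finite E" using E assms finite_subset by blast
  define h where "h = (\<lambda>v. LEAST k. (r, v) \<in> E ^^ k)"
  have h: "(r, v) \<in> E ^^ h v" if v: "v \<in> V" for v
  proof -
    have "(r, v) \<in> E\<^sup>*" using conn r v by auto
    then show ?thesis unfolding h_def by (metis LeastI rtrancl_imp_relpow)
  qed
  have "\<exists>u. (u, v) \<in> E \<and> h u < h v" if v: "v \<in> V - {r}" for v
  proof (cases "h v")
    case 0
    then show ?thesis using h[of v] v by auto
  next
    case (Suc k)
    then have "(r, v) \<in> E ^^ Suc k" using h[of v] v by auto
    then obtain u where u: "(r, u) \<in> E ^^ k" "(u, v) \<in> E" by auto
    then have "h u \<le> k" unfolding h_def by (intro Least_le)
    then show ?thesis using u Suc by auto
  qed
  then obtain p where p: "\<And>v. v \<in> V - {r} \<Longrightarrow> (p v, v) \<in> E \<and> h (p v) < h v" by metis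
  define F where "F = (\<lambda>v. (p v, v)) ` (V - {r})"
  have "card F = card (V - {r})" unfolding F_def by (intro card_image) (auto simp: inj_on_def)
  then have cF: "card F = card V - 1" using r assms by simp
  have fF: "finite F" using assms by (simp add: F_def)
  have "F \<inter> F\<inverse> = {}"
  proof -
    have "h u < h w" if "(u, w) \<in> F" for u w using that p by (auto simp: F_def)
    then have "(w, u) \<notin> F" if "(u, w) \<in> F" for u w using that by (metis less_asym)
    then show ?thesis by auto
  qed
  moreover have "F \<union> F\<inverse> \<subseteq> E" using p E(2) by (auto simp: F_def sym_def)
  ultimately have "card F + card (F\<inverse>) \<le> card E"
    using fF fE card_Un_disjoint[of F "F\<inverse>"] card_mono[of E "F \<union> F\<inverse>"] by simp
  then show ?thesis using cF realizes_sum[OF assms(1,2)] by simp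
qed auto

section \<open>Coranks of partitions\<close>

definition corank_ok :: "int \<Rightarrow> nat list \<Rightarrow> bool" where
  "corank_ok s p \<longleftrightarrow> (\<forall>j\<in>{1..durfee p}. int j \<le> s + (\<Sum>i=1..j. corank p i))"

lemma row_len_nth: "\<lbrakk>1 \<le> i; i \<le> length p\<rbrakk> \<Longrightarrow> row_len p i = p ! (i - 1)"
proof -
  assume "1 \<le> i" "i \<le> length p"
  then have "{j. (i, j) \<in> ferrers p} = {1..p ! (i - 1)}" by (auto simp: ferrers_def)
  then show ?thesis by (simp add: row_len_def)
qed

lemma col_len_card: "1 \<le> j \<Longrightarrow> col_len p j = card {m. m < length p \<and> j \<le> p ! m}"
proof -
  assume "1 \<le> j"
  then have "{i. (i, j) \<in> ferrers p} = Suc ` {m. m < length p \<and> j \<le> p ! m}"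
    by (auto simp: ferrers_def image_iff) (metis Suc_diff_Suc Suc_le_lessD diff_Suc_1 diff_zero)
  then show ?thesis by (simp add: col_len_def card_image)
qed

lemma le_durfee_iff:
  assumes "is_partition p"
  shows "j \<le> durfee p \<longleftrightarrow> j = 0 \<or> j \<le> length p \<and> j \<le> p ! (j - 1)"
proof -
  let ?M = "{m. {1..m} \<times> {1..m} \<subseteq> ferrers p}"
  have sub: "m \<in> ?M \<longleftrightarrow> m = 0 \<or> m \<le> length p \<and> m \<le> p ! (m - 1)" for m
  proof (cases "m = 0")
    case False
    show ?thesis
    proof
      assume "m \<in> ?M"
      then have "(m, m) \<in> ferrers p" using False by auto
      then show "m = 0 \<or> m \<le> length p \<and> m \<le> p ! (m - 1)" by (auto simp: ferrers_def)
    next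
      assume m: "m = 0 \<or> m \<le> length p \<and> m \<le> p ! (m - 1)"
      have "j \<le> p ! (i - 1)" if "i \<in> {1..m}" "j \<in> {1..m}" for i j
      proof -
        have "p ! (m - 1) \<le> p ! (i - 1)"
        proof (cases "i = m")
          case False
          then show ?thesis
            using assms m that sorted_wrt_nth_less[of "(\<ge>)" p "i - 1" "m - 1"]
            by (auto simp: is_partition_def)
        qed simp
        then show ?thesis using that m False by auto
      qed
      then show "m \<in> ?M" using m False by (auto simp: ferrers_def)
    qed
  qed simp
  have "finite ?M" by (rule finite_subset[of _ "{..length p}"]) (use sub in auto)
  moreover have "0 \<in> ?M" by simp
  ultimately have Max: "durfee p \<in> ?M" "\<And>m. m \<in> ?M \<Longrightarrow> m \<le> durfee p"
    unfolding durfee_def using Max_in[of ?M] Max_ge[of ?M] by (blast, blast)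
  have "j \<in> ?M" if "j \<le> durfee p"
  proof -
    have "{1..j} \<times> {1..j} \<subseteq> {1..durfee p} \<times> {1..durfee p}" using that by auto
    then show ?thesis using Max(1) by blast
  qed
  then show ?thesis using Max(2)[of j] sub[of j] by blast
qed

text \<open>
  The first \<open>j\<close> columns together contain \<open>min (p ! m) j\<close> dots of row \<open>m\<close>.  This is the bridge
  between coranks and Erdos-Gallai inequalities.
\<close>

lemma sum_corank:
  assumes "j \<le> length p"
  shows "(\<Sum>i=1..j. corank p i)
    = (\<Sum>m<length p. int (min (p ! m) j)) - (\<Sum>m<j. int (p ! m))"
proof -
  have "(\<Sum>i=1..j. int (col_len p i)) = (\<Sum>i=1..j. \<Sum>m<length p. if i \<le> p ! m then 1 else 0)"
  proof (rule sum.cong[OF refl])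
    fix i assume "i \<in> {1..j}"
    then have "col_len p i = card {m \<in> {..<length p}. i \<le> p ! m}" by (simp add: col_len_card)
    also have "\<dots> = (\<Sum>m<length p. if i \<le> p ! m then 1 else 0)"
      by (simp add: sum.If_cases Int_def)
    finally show "int (col_len p i) = (\<Sum>m<length p. if i \<le> p ! m then 1 else 0)"
      by (simp add: of_nat_sum if_distrib[of int] cong: if_cong)
  qed
  also have "\<dots> = (\<Sum>m<length p. \<Sum>i=1..j. if i \<le> p ! m then 1 else 0)" by (rule sum.swap)
  also have "\<dots> = (\<Sum>m<length p. int (min (p ! m) j))"
  proof (rule sum.cong[OF refl])
    fix m
    have "{1..j} \<inter> {i. i \<le> p ! m} = {1..min (p ! m) j}" by auto
    then show "(\<Sum>i=1..j. if i \<le> p ! m then 1 else 0) = int (min (p ! m) j)"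
      by (simp add: sum.If_cases)
  qed
  finally have col: "(\<Sum>i=1..j. int (col_len p i)) = (\<Sum>m<length p. int (min (p ! m) j))" .
  have "(\<Sum>i=1..j. int (row_len p i)) = (\<Sum>i=1..j. int (p ! (i - 1)))"
    using assms by (intro sum.cong) (auto simp: row_len_nth)
  also have "\<dots> = (\<Sum>m<j. int (p ! m))"
    by (rule sum.reindex_bij_witness[of _ Suc "\<lambda>i. i - 1"]) auto
  finally show ?thesis using col by (simp add: corank_def sum_subtractf)
qed

section \<open>Removing the first row and column\<close>

text \<open>
  The partition whose diagram is that of \<open>p\<close> surrounded by a first row of length \<open>k + 1\<close> and a
  first column of length \<open>l + 1\<close>.
\<close>

definition hook :: "nat \<Rightarrow> nat \<Rightarrow> nat list \<Rightarrow> nat list" where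
  "hook k l p = Suc k # map Suc (p @ replicate (l - length p) 0)"

definition box :: "nat \<Rightarrow> nat \<Rightarrow> nat list set" where
  "box k l = {p. is_partition p \<and> length p \<le> l \<and> (\<forall>x\<in>set p. x \<le> k)}"

lemma finite_box: "finite (box k l)"
proof (rule finite_subset)
  show "box k l \<subseteq> {p. set p \<subseteq> {..k} \<and> length p \<le> l}" by (auto simp: box_def)
qed (rule finite_lists_length_le, simp)

lemma sorted_desc_split_zeros:
  assumes "sorted_wrt (\<ge>) (p :: nat list)"
  shows "filter (\<lambda>x. 0 < x) p @ replicate (length p - length (filter (\<lambda>x. 0 < x) p)) 0 = p"
  using assms
proof (induction p)
  case (Cons x p)
  show ?case
  proof (cases "x = 0")
    case True
    then have "\<forall>y\<in>set p. y = 0" using Cons.prems by auto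
    then have "filter (\<lambda>x. 0 < x) p = []" "p = replicate (length p) 0"
      by (auto simp: filter_empty_conv intro: replicate_eqI)
    then show ?thesis using True by simp
  qed (use Cons in auto)
qed simp

lemma inj_on_hook: "inj_on (hook k l) (box k' l')"
proof (rule inj_onI)
  fix p q assume pq: "p \<in> box k' l'" "q \<in> box k' l'" "hook k l p = hook k l q"
  have eq: "p @ replicate (l - length p) 0 = q @ replicate (l - length q) 0"
    using pq(3) by (simp add: hook_def inj_map_eq_map del: map_append)
  have "filter (\<lambda>x. 0 < x) (r @ replicate (l - length r) 0) = r" if "is_partition r" for r
    using that by (simp add: is_partition_def filter_replicate)
  then show "p = q" using pq eq by (metis (no_types, lifting) box_def mem_Collect_eq)
qed

lemma hook_image:
  "hook k l ` box k l = {q. is_partition q \<and> length q = Suc l \<and> q ! 0 = Suc k}"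
proof (intro set_eqI iffI)
  fix q assume "q \<in> hook k l ` box k l"
  then obtain p where p: "p \<in> box k l" "q = hook k l p" by auto
  have "sorted_wrt (\<ge>) (p @ replicate (l - length p) 0)"
  proof -
    have "sorted_wrt (\<ge>) (replicate m (0 :: nat))" for m by (induction m) auto
    then show ?thesis using p by (auto simp: box_def is_partition_def sorted_wrt_append)
  qed
  then have "sorted_wrt (\<ge>) (map Suc (p @ replicate (l - length p) 0))"
    unfolding sorted_wrt_map by simp
  then show "q \<in> {q. is_partition q \<and> length q = Suc l \<and> q ! 0 = Suc k}"
    using p by (auto simp: box_def is_partition_def hook_def)
next
  fix q assume q: "q \<in> {q. is_partition q \<and> length q = Suc l \<and> q ! 0 = Suc k}"
  then obtain r where r: "q = Suc k # r" "length r = l" by (cases q) auto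
  define m where "m = map (\<lambda>x. x - 1) r"
  define p where "p = filter (\<lambda>x. 0 < x) m"
  have sr: "sorted_wrt (\<ge>) r" "\<forall>x\<in>set r. 0 < x \<and> x \<le> Suc k"
    using q r by (auto simp: is_partition_def)
  have sm: "sorted_wrt (\<ge>) m"
    unfolding m_def sorted_wrt_map by (rule sorted_wrt_mono_rel[OF _ sr(1)]) auto
  have "map Suc m = r" using sr(2) by (auto simp: m_def map_idI)
  moreover have "p @ replicate (l - length p) 0 = m"
    using sorted_desc_split_zeros[OF sm] r by (simp add: p_def m_def)
  ultimately have "hook k l p = q" using r by (simp add: hook_def del: map_append)
  moreover have "p \<in> box k l"
    using sm sr r sorted_wrt_filter[OF sm] length_filter_le[of _ m]
    by (fastforce simp: box_def is_partition_def p_def m_def)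
  ultimately show "q \<in> hook k l ` box k l" by blast
qed

lemma sum_list_hook: "p \<in> box k l \<Longrightarrow> sum_list (hook k l p) = sum_list p + k + l + 1"
proof -
  assume "p \<in> box k l"
  moreover have "sum_list (map Suc r) = sum_list r + length r" for r by (induction r) auto
  ultimately show ?thesis by (simp add: hook_def box_def del: map_append)
qed

text \<open>
  The first corank of the extended partition is \<open>l - k\<close>, the others are those of \<open>p\<close>, and the
  Durfee size grows by one.  The first of the inequalities becomes the condition that the new
  parameter be nonnegative.
\<close>

lemma corank_ok_hook:
  assumes p: "p \<in> box k l"
  shows "corank_ok s (hook k l p)
    \<longleftrightarrow> 0 \<le> s + int l - int k - 1 \<and> corank_ok (s + int l - int k - 1) p"
proof -
  define q where "q = hook k l p"
  have pp: "is_partition p" "length p \<le> l" "\<And>x. x \<in> set p \<Longrightarrow> x \<le> k"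
    using p by (auto simp: box_def)
  have "q \<in> hook k l ` box k l" using p by (simp add: q_def)
  then have qp: "is_partition q" "length q = Suc l" by (simp_all add: hook_image)
  have q0: "q ! 0 = Suc k" by (simp add: q_def hook_def)
  have qS: "q ! Suc m = (if m < length p then Suc (p ! m) else 1)" if "m < l" for m
    using that pp(2) by (simp add: q_def hook_def nth_append)
  have "Suc j \<le> durfee q \<longleftrightarrow> j \<le> durfee p" for j
    using qS[of "j - 1"] q0 pp(2)
    by (cases j) (auto split: if_splits simp: le_durfee_iff[OF pp(1)] le_durfee_iff[OF qp(1)] qp(2))
  then have dq: "durfee q = Suc (durfee p)" by (metis Suc_le_D le_antisym le_refl Suc_le_mono zero_le)
  have c1: "corank q 1 = int l - int k"
  proof -
    have "m < Suc l \<Longrightarrow> 1 \<le> q ! m" for m using q0 qS by (cases m) auto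
    then have "{m. m < Suc l \<and> 1 \<le> q ! m} = {..<Suc l}" by auto
    then show ?thesis using q0 qp(2) by (simp add: corank_def row_len_nth col_len_card)
  qed
  have cS: "corank q (Suc i) = corank p i" if i: "1 \<le> i" "i \<le> durfee p" for i
  proof -
    have ip: "i \<le> length p" "i \<le> p ! (i - 1)" using le_durfee_iff[OF pp(1), of i] i by auto
    have "p ! (i - 1) \<in> set p" using ip i by (intro nth_mem) auto
    then have ik: "i \<le> k" using pp(3)[of "p ! (i - 1)"] ip by linarith
    have "{m. m < Suc l \<and> Suc i \<le> q ! m} = insert 0 (Suc ` {m. m < length p \<and> i \<le> p ! m})"
    proof (rule set_eqI)
      fix m show "m \<in> {m. m < Suc l \<and> Suc i \<le> q ! m} \<longleftrightarrow> m \<in> insert 0 (Suc ` {m. m < length p \<and> i \<le> p ! m})"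
        using q0 qS pp(2) ik i by (cases m) (auto split: if_splits)
    qed
    then have "col_len q (Suc i) = Suc (col_len p i)"
      using i by (simp add: col_len_card qp(2) card_image)
    moreover have "row_len q (Suc i) = Suc (row_len p i)"
      using qS[of "i - 1"] ip i pp(2) by (cases i) (simp_all add: row_len_nth qp(2))
    ultimately show ?thesis by (simp add: corank_def)
  qed
  have sums: "(\<Sum>i=1..Suc j. corank q i) = int l - int k + (\<Sum>i=1..j. corank p i)"
    if "j \<le> durfee p" for j
  proof -
    have "(\<Sum>i=1..Suc j. corank q i) = corank q 1 + (\<Sum>i=Suc 1..Suc j. corank q i)"
      by (simp add: sum.atLeast_Suc_atMost del: sum.cl_ivl_Suc)
    also have "(\<Sum>i=Suc 1..Suc j. corank q i) = (\<Sum>i=1..j. corank q (Suc i))"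
      by (rule sum.shift_bounds_cl_Suc_ivl)
    also have "\<dots> = (\<Sum>i=1..j. corank p i)" using that cS by (intro sum.cong) auto
    finally show ?thesis using c1 by simp
  qed
  have split: "(\<forall>j\<in>{1..Suc n}. P j) \<longleftrightarrow> P 1 \<and> (\<forall>j\<in>{1..n}. P (Suc j))" for n and P :: "nat \<Rightarrow> bool"
  proof -
    have "{1..Suc n} = insert 1 (Suc ` {1..n})" unfolding image_Suc_atLeastAtMost by auto
    then show ?thesis by (simp del: image_Suc_atLeastAtMost)
  qed
  have s0: "(\<Sum>i=1..1. corank q i) = int l - int k" using sums[of 0] by simp
  have "corank_ok s q \<longleftrightarrow> int 1 \<le> s + (\<Sum>i=1..1. corank q i) \<and>
      (\<forall>j\<in>{1..durfee p}. int (Suc j) \<le> s + (\<Sum>i=1..Suc j. corank q i))"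
    unfolding corank_ok_def dq split ..
  also have "\<dots> \<longleftrightarrow> 1 \<le> s + (int l - int k) \<and>
      (\<forall>j\<in>{1..durfee p}. int (Suc j) \<le> s + (int l - int k + (\<Sum>i=1..j. corank p i)))"
    unfolding s0 using sums by simp
  also have "\<dots> \<longleftrightarrow> 0 \<le> s + int l - int k - 1 \<and> corank_ok (s + int l - int k - 1) p"
    unfolding corank_ok_def by (auto simp: algebra_simps)
  finally show ?thesis by (simp add: q_def)
qed

section \<open>A recurrence\<close>

text \<open>
  The offset \<open>x\<close> encodes what the parts removed so far contribute to the two requirements on the
  sum of the whole sequence, its parity and its lower bound.
\<close>

definition tail_count :: "int \<Rightarrow> nat \<Rightarrow> nat \<Rightarrow> int \<Rightarrow> int" where
  "tail_count x k l s = (if s < 0 then 0 else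
     int (card {p \<in> box k l. corank_ok s p \<and> 0 \<le> int (sum_list p) + x \<and> even (int (sum_list p) + x)}))"

lemma tail_count_neg: "s < 0 \<Longrightarrow> tail_count x k l s = 0"
  by (simp add: tail_count_def)

lemma tail_count_base:
  assumes "k = 0 \<or> l = 0" "0 \<le> s"
  shows "tail_count x k l s = (if 0 \<le> x \<and> even x then 1 else 0)"
proof -
  have "p \<in> box k l \<longleftrightarrow> p = []" for p
    using assms(1) by (cases p) (auto simp: box_def is_partition_def)
  then have "box k l = {[]}" by blast
  moreover have "\<not> 1 \<le> durfee []" by (subst le_durfee_iff) (simp_all add: is_partition_def)
  then have "corank_ok s []" by (simp add: corank_ok_def)
  ultimately have "{p \<in> box k l. corank_ok s p \<and> 0 \<le> int (sum_list p) + x \<and> even (int (sum_list p) + x)}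
      = (if 0 \<le> x \<and> even x then {[]} else {})"
    by (simp add: Collect_conv_if conj_commute)
  then show ?thesis using assms(2) by (simp add: tail_count_def)
qed

lemma tail_count_pos_shift:
  assumes "0 < x"
  shows "tail_count x k l s = tail_count (x - 2) k l s"
proof -
  have "(0 \<le> int m + x \<and> even (int m + x)) \<longleftrightarrow> (0 \<le> int m + (x - 2) \<and> even (int m + (x - 2)))" for m
    using assms by (auto simp: even_diff) presburger
  then show ?thesis by (simp add: tail_count_def)
qed

text \<open>
  A partition in the larger box misses the largest allowed part, or it misses the largest allowed
  number of parts, or it attains both; in the last case its first row and column can be removed.
\<close>

lemma tail_count_rec:
  assumes "0 \<le> s"
  shows "tail_count x (Suc k) (Suc l) s = tail_count x k (Suc l) s + tail_count x (Suc k) l s - tail_count x k l s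
    + tail_count (x + int k + int l + 1) k l (s + int l - int k - 1)"
proof -
  define Q where "Q = (\<lambda>p. corank_ok s p \<and> 0 \<le> int (sum_list p) + x \<and> even (int (sum_list p) + x))"
  define s' where "s' = s + int l - int k - 1"
  define x' where "x' = x + int k + int l + 1"
  define H where "H = {p \<in> hook k l ` box k l. Q p}"
  define R where "R = {p \<in> box k l. 0 \<le> s' \<and> corank_ok s' p \<and> 0 \<le> int (sum_list p) + x' \<and> even (int (sum_list p) + x')}"
  let ?S = "\<lambda>k l. {p \<in> box k l. Q p}"
  have fin: "finite (?S k l)" for k l using finite_box by simp
  have "H = hook k l ` R"
    unfolding H_def R_def Q_def s'_def x'_def
    using corank_ok_hook[of _ k l s] sum_list_hook[of _ k l] by (fastforce simp: algebra_simps)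
  moreover have "inj_on (hook k l) R"
    by (rule inj_on_subset[OF inj_on_hook[of k l k l]]) (auto simp: R_def)
  ultimately have cH: "int (card H) = tail_count x' k l s'"
    by (auto simp: card_image tail_count_def R_def)
  have finH: "finite H" using finite_box by (simp add: H_def)
  have un: "?S (Suc k) (Suc l) = (?S k (Suc l) \<union> ?S (Suc k) l) \<union> H"
  proof -
    have "p \<in> box k (Suc l) \<or> p \<in> box (Suc k) l \<or> p \<in> hook k l ` box k l" if p: "p \<in> box (Suc k) (Suc l)" for p
    proof (cases "length p = Suc l \<and> p ! 0 = Suc k")
      case True
      then show ?thesis using p unfolding hook_image by (simp add: box_def)
    next
      case F: False
      show ?thesis
      proof (cases "length p = Suc l")
        case True
        then obtain y r where yr: "p = y # r" by (cases p) auto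
        then have "y \<noteq> Suc k" using F True by auto
        then have "\<forall>x\<in>set p. x \<le> k" using p yr by (auto simp: box_def is_partition_def dest: order_trans)
        then show ?thesis using p by (auto simp: box_def)
      next
        case False
        then show ?thesis using p by (auto simp: box_def)
      qed
    qed
    moreover have "box k (Suc l) \<subseteq> box (Suc k) (Suc l)" "box (Suc k) l \<subseteq> box (Suc k) (Suc l)"
      by (auto simp: box_def)
    moreover have "hook k l ` box k l \<subseteq> box (Suc k) (Suc l)"
    proof
      fix q assume "q \<in> hook k l ` box k l"
      then have q: "is_partition q" "length q = Suc l" "q ! 0 = Suc k" by (auto simp: hook_image)
      then show "q \<in> box (Suc k) (Suc l)"
        by (cases q) (auto simp: box_def is_partition_def)
    qed
    ultimately show ?thesis unfolding H_def by blast
  qed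
  have int: "?S k (Suc l) \<inter> ?S (Suc k) l = ?S k l" by (auto simp: box_def)
  have dis: "(?S k (Suc l) \<union> ?S (Suc k) l) \<inter> H = {}"
  proof -
    have "q \<notin> box k (Suc l) \<and> q \<notin> box (Suc k) l" if "q \<in> hook k l ` box k l" for q
    proof -
      have q: "length q = Suc l" "q ! 0 = Suc k" using that by (auto simp: hook_image)
      then have "Suc k \<in> set q" by (metis nth_mem zero_less_Suc)
      then have "q \<notin> box k (Suc l)" unfolding box_def by (auto intro: bexI[of _ "Suc k"])
      then show ?thesis using q(1) by (simp add: box_def)
    qed
    then show ?thesis by (auto simp: H_def)
  qed
  have "int (card (?S (Suc k) (Suc l))) = int (card (?S k (Suc l) \<union> ?S (Suc k) l)) + int (card H)"
    using card_Un_disjoint[OF _ finH dis] fin un by simp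
  moreover have "int (card (?S k (Suc l) \<union> ?S (Suc k) l)) + int (card (?S k l))
      = int (card (?S k (Suc l))) + int (card (?S (Suc k) l))"
    using card_Un_Int[OF fin[of k "Suc l"] fin[of "Suc k" l]] int by simp
  ultimately show ?thesis
    using assms cH by (simp add: tail_count_def Q_def s'_def x'_def)
qed

section \<open>Potentially connected degree sequences\<close>

lemma partition_nth_mono:
  assumes "is_partition p" "i \<le> j" "j < length p"
  shows "p ! j \<le> p ! i"
  using assms sorted_wrt_nth_less[of "(\<ge>)" p i j] by (cases "i = j") (auto simp: is_partition_def)

lemma card_le_Suc_Max: "finite A \<Longrightarrow> A \<noteq> {} \<Longrightarrow> card A \<le> Suc (Max A)" for A :: "nat set"
proof -
  assume "finite A" "A \<noteq> {}"
  then have "A \<subseteq> {..Max A}" by auto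
  then show ?thesis using card_mono[of "{..Max A}" A] by simp
qed

lemma sum_le_prefix_sum:
  assumes "is_partition p" "A \<subseteq> {..<length p}"
  shows "(\<Sum>i\<in>A. int (p ! i)) \<le> (\<Sum>i<card A. int (p ! i))"
  using assms(2)
proof (induction "card A" arbitrary: A)
  case 0
  then show ?case using finite_subset by fastforce
next
  case (Suc a)
  have fin: "finite A" and "A \<noteq> {}" using Suc.hyps(2) card_gt_0_iff[of A] by auto
  define x where "x = Max A"
  have x: "x \<in> A" "a \<le> x"
    using Max_in[OF fin \<open>A \<noteq> {}\<close>] card_le_Suc_Max[OF fin \<open>A \<noteq> {}\<close>] Suc.hyps(2) by (auto simp: x_def)
  have c: "card (A - {x}) = a" using Suc.hyps(2) x fin by simp
  have "(\<Sum>i\<in>A. int (p ! i)) = int (p ! x) + (\<Sum>i\<in>A - {x}. int (p ! i))"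
    using fin x by (simp add: sum.remove)
  also have "\<dots> \<le> int (p ! a) + (\<Sum>i<a. int (p ! i))"
  proof -
    have "x < length p" "A - {x} \<subseteq> {..<length p}" using x Suc.prems by auto
    then show ?thesis
      using Suc.hyps(1)[of "A - {x}"] c partition_nth_mono[OF assms(1) x(2)] by simp
  qed
  finally show ?case using Suc.hyps(2)[symmetric] by simp
qed

text \<open>
  For \<open>card A\<close> at most the Durfee size \<open>m\<close>, the corank condition at \<open>j = card A\<close> gives the
  inequality.  A larger \<open>A\<close> contains a vertex whose degree is at most \<open>m\<close>; dropping it from \<open>A\<close>
  does not increase the slack.
\<close>

lemma corank_ok_imp_erdos_gallai:
  assumes p: "is_partition p" and ok: "corank_ok 0 p"
  shows "erdos_gallai {..<length p} ((!) p)"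
proof -
  let ?V = "{..<length p}"
  have "0 \<le> slack ?V ((!) p) A B" if "A \<subseteq> ?V" "B \<subseteq> ?V" "A \<inter> B = {}" for A B
    using that
  proof (induction "card A" arbitrary: A rule: less_induct)
    case less
    define a where "a = card A"
    have fin: "finite A" "finite B" using less.prems finite_subset by blast+
    show ?case
    proof (cases "a \<le> durfee p")
      case True
      show ?thesis
      proof (cases "a = 0")
        case True
        then have "A = {}" using fin by (simp add: a_def)
        then show ?thesis by (simp add: slack_def sum_nonneg)
      next
        case False
        have "a \<le> length p" using card_mono[of ?V A] less.prems by (simp add: a_def)
        moreover have "int a \<le> (\<Sum>i=1..a. corank p i)"
          using ok True False by (auto simp: corank_ok_def)
        moreover have "(\<Sum>i\<in>A. int (p ! i)) \<le> (\<Sum>i<a. int (p ! i))"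
          using sum_le_prefix_sum[OF p less.prems(1)] by (simp add: a_def)
        ultimately have 1: "int a + (\<Sum>i\<in>A. int (p ! i)) \<le> (\<Sum>i\<in>?V. int (min (p ! i) a))"
          using sum_corank[of a p] by simp
        have "?V = A \<union> (B \<union> (?V - A - B))" using less.prems by auto
        moreover have "A \<inter> (B \<union> (?V - A - B)) = {}" "B \<inter> (?V - A - B) = {}" using less.prems by auto
        ultimately have "(\<Sum>i\<in>?V. int (min (p ! i) a)) = (\<Sum>i\<in>A. int (min (p ! i) a))
            + ((\<Sum>i\<in>B. int (min (p ! i) a)) + (\<Sum>i\<in>?V - A - B. int (min (p ! i) a)))"
          using fin by (metis (no_types, lifting) finite_Diff finite_Un finite_lessThan sum.union_disjoint)
        moreover have "(\<Sum>i\<in>A. int (min (p ! i) a)) \<le> int a * int a"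
          using sum_bounded_above[of A "\<lambda>i. int (min (p ! i) a)" "int a"] by (simp add: a_def)
        moreover have "(\<Sum>i\<in>B. int (min (p ! i) a)) \<le> int a * int (card B)"
          using sum_bounded_above[of B "\<lambda>i. int (min (p ! i) a)" "int a"] by (simp add: mult.commute)
        moreover have "(\<Sum>i\<in>?V - A - B. int (min (p ! i) a)) \<le> (\<Sum>i\<in>?V - A - B. int (p ! i))"
          by (intro sum_mono) simp
        ultimately show ?thesis using 1 by (simp add: slack_def a_def[symmetric] algebra_simps)
      qed
    next
      case False
      then have "A \<noteq> {}" by (auto simp: a_def)
      define x where "x = Max A"
      have x: "x \<in> A" "durfee p \<le> x"
        using Max_in[OF fin(1) \<open>A \<noteq> {}\<close>] card_le_Suc_Max[OF fin(1) \<open>A \<noteq> {}\<close>] False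
        by (auto simp: x_def a_def)
      have xl: "x < length p" using x less.prems by auto
      have "\<not> Suc (durfee p) \<le> durfee p" by simp
      then have "p ! durfee p \<le> durfee p"
        unfolding le_durfee_iff[OF p, of "Suc (durfee p)"] using x xl by auto
      then have px: "p ! x \<le> durfee p" using partition_nth_mono[OF p x(2) xl] by simp
      have xB: "x \<notin> B" using x less.prems by auto
      have s: "A - {x} \<subseteq> ?V" "insert x B \<subseteq> ?V" "(A - {x}) \<inter> insert x B = {}" "B \<subseteq> ?V"
          "(A - {x}) \<inter> B = {}"
        using x less.prems by auto
      have cA: "card (A - {x}) = a - 1" "a \<ge> 1" "card (A - {x}) < card A" using x fin False
        by (auto simp: a_def card_gt_0_iff Suc_le_eq)
      have "0 \<le> slack ?V ((!) p) (A - {x}) B"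
        by (rule less.hyps[OF cA(3) s(1,4,5)])
      moreover have "slack ?V ((!) p) (A - {x}) (insert x B - {x})
          = slack ?V ((!) p) (A - {x}) (insert x B) + int (p ! x) - int (card (A - {x}))"
        by (rule slack_drop[OF _ s(1,2,3)]) auto
      moreover have "slack ?V ((!) p) (A - {x}) (insert x B)
          = slack ?V ((!) p) A B + int (p ! x) - (int (card A) + int (card B) - 1)"
        by (rule slack_move[OF _ less.prems x(1)]) auto
      moreover have "insert x B - {x} = B" using xB by auto
      ultimately show ?thesis using px False cA a_def by (simp add: of_nat_diff)
    qed
  qed
  then show ?thesis by (simp add: erdos_gallai_def)
qed

lemma connected_rtrancl:
  assumes "pair_graph G"
  shows "connected (with_proj G) \<longleftrightarrow> pverts G \<noteq> {} \<and> pverts G \<times> pverts G \<subseteq> (parcs G)\<^sup>*"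
proof -
  interpret pair_graph G by fact
  have s: "(parcs G)\<^sup>s = parcs G"
    using arcs_symmetric by (auto simp: symcl_def)
  have "(u, v) \<in> rtrancl_on (pverts G) (parcs G) \<longleftrightarrow> (u, v) \<in> (parcs G)\<^sup>*" if "u \<in> pverts G" for u v
  proof
    assume "(u, v) \<in> rtrancl_on (pverts G) (parcs G)"
    then show "(u, v) \<in> (parcs G)\<^sup>*" by induction (auto intro: rtrancl.rtrancl_into_rtrancl)
  next
    assume "(u, v) \<in> (parcs G)\<^sup>*"
    then show "(u, v) \<in> rtrancl_on (pverts G) (parcs G)"
      by induction (use that in_arcsD2 in \<open>auto intro: rtrancl_on_into_rtrancl_on\<close>)
  qed
  then show ?thesis by (auto simp: connected_conv s)
qed

lemma out_degree_card: "out_degree (with_proj G) v = card (parcs G `` {v})"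
proof -
  have "parcs G `` {v} = snd ` {e \<in> parcs G. fst e = v}" by force
  then show ?thesis
    by (simp add: out_degree_def out_arcs_def card_image inj_on_def prod_eq_iff)
qed

lemma pair_graph_realizes:
  assumes "pair_graph G"
  shows "realizes (pverts G) (parcs G) (out_degree (with_proj G))"
proof -
  interpret pair_graph G by fact
  have "(v, v) \<notin> parcs G" for v using no_loops'[of v v] by blast
  then show ?thesis
    using arcs_symmetric in_arcsD1 in_arcsD2
    by (auto simp: realizes_def sym_def irrefl_def out_degree_card)
qed

lemma realizes_pair_graph:
  assumes "finite V" "realizes V E d"
  shows "pair_graph \<lparr>pverts = V, parcs = E\<rparr>"
proof -
  have E: "E \<subseteq> V \<times> V" "sym E" "irrefl E" using assms by (auto simp: realizes_def)
  moreover have "finite E" using E(1) assms(1) finite_subset by blast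
  ultimately show ?thesis
    using assms(1) by unfold_locales (auto simp: irrefl_def symmetric_def)
qed

lemma mset_image_mset_setD:
  assumes "mset xs = image_mset f (mset_set V)" "finite V"
  shows "\<exists>vs. distinct vs \<and> set vs = V \<and> map f vs = xs"
  using assms
proof (induction xs arbitrary: V)
  case Nil
  then show ?case by (auto simp: mset_set_empty_iff)
next
  case (Cons x xs)
  have "x \<in># image_mset f (mset_set V)" by (metis Cons.prems(1) list.set_intros(1) set_mset_mset)
  then obtain v where v: "v \<in> V" "f v = x" using Cons.prems(2) by auto
  have "mset_set V = add_mset v (mset_set (V - {v}))"
    using v Cons.prems(2) by (simp add: mset_set.remove)
  then have "mset xs = image_mset f (mset_set (V - {v}))" using Cons.prems(1) v by simp
  then obtain vs where "distinct vs" "set vs = V - {v}" "map f vs = xs"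
    using Cons.IH[of "V - {v}"] Cons.prems(2) by auto
  then show ?case using v by (intro exI[of _ "v # vs"]) auto
qed

lemma conn_deg_seqs_iff:
  assumes n: "1 \<le> n"
  shows "d \<in> conn_deg_seqs n \<longleftrightarrow> is_partition d \<and> length d = n \<and> corank_ok 0 d
    \<and> even (sum_list d) \<and> 2 * (n - 1) \<le> sum_list d"
proof
  assume "d \<in> conn_deg_seqs n"
  then obtain G where len: "length d = n" and pos: "\<forall>x\<in>set d. 1 \<le> x" and G: "pair_graph G"
      "card (pverts G) = n" "connected (with_proj G)" and ds: "is_degree_seq G d"
    by (auto simp: conn_deg_seqs_def deg_seqs_def)
  interpret pair_graph G by fact
  define V deg where "V = pverts G" and "deg = out_degree (with_proj G)"
  have fV: "finite V" by (simp add: V_def pair_finite_verts)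
  have R: "realizes V (parcs G) deg" unfolding V_def deg_def by (rule pair_graph_realizes[OF G(1)])
  have dp: "is_partition d" using ds pos by (auto simp: is_partition_def is_degree_seq_def Suc_le_eq)
  obtain vs where vs: "distinct vs" "set vs = V" "map deg vs = d"
    using mset_image_mset_setD[of d deg V] ds fV by (auto simp: is_degree_seq_def V_def deg_def)
  have lvs: "length vs = n" using vs len by auto
  have dn: "d ! i = deg (vs ! i)" if "i < n" for i using vs lvs that by auto
  have bij: "bij_betw ((!) vs) {..<n} V" using vs lvs by (intro bij_betw_nth) auto
  have sumV: "(\<Sum>v\<in>V. f v) = (\<Sum>i<n. f (vs ! i))" for f :: "nat \<Rightarrow> nat"
    using sum.reindex_bij_betw[OF bij, of f] by simp
  have "sum_list d = (\<Sum>i<n. d ! i)" by (simp add: sum_list_sum_nth len atLeast0LessThan)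
  then have sumd: "sum_list d = sum deg V" using dn sumV by simp
  have "corank_ok 0 d"
    unfolding corank_ok_def
  proof
    fix j assume j: "j \<in> {1..durfee d}"
    then have jd: "j \<le> n" "j \<le> d ! (j - 1)" using le_durfee_iff[OF dp, of j] len by auto
    define A where "A = (!) vs ` {..<j}"
    have inj: "inj_on ((!) vs) {..<j}" using bij jd by (auto simp: bij_betw_def intro: inj_on_subset)
    have cA: "card A = j" using inj by (simp add: A_def card_image)
    have "A \<subseteq> V" using bij jd by (auto simp: A_def bij_betw_def)
    moreover have "card A \<le> deg v" if "v \<in> A" for v
    proof -
      obtain i where i: "i < j" "v = vs ! i" using \<open>v \<in> A\<close> by (auto simp: A_def)
      then have "d ! (j - 1) \<le> d ! i" using partition_nth_mono[OF dp, of i "j - 1"] jd len by auto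
      then show ?thesis using i jd dn[of i] cA by simp
    qed
    ultimately have "sum deg A + j \<le> (\<Sum>v\<in>V. min (deg v) j)"
      using realizes_erdos_gallai[OF fV R, of A] cA by simp
    moreover have "sum deg A = (\<Sum>i<j. d ! i)"
      using inj dn jd by (simp add: A_def sum.reindex)
    moreover have "(\<Sum>v\<in>V. min (deg v) j) = (\<Sum>i<n. min (d ! i) j)" using sumV dn by simp
    ultimately have "(\<Sum>i<j. d ! i) + j \<le> (\<Sum>i<n. min (d ! i) j)" by simp
    then have "int ((\<Sum>i<j. d ! i) + j) \<le> int (\<Sum>i<n. min (d ! i) j)" by (simp only: of_nat_le_iff)
    then show "int j \<le> 0 + (\<Sum>i=1..j. corank d i)"
      using sum_corank[of j d] jd len by simp
  qed
  moreover have "even (sum_list d)" using realizes_even[OF fV R] sumd by simp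
  moreover have "2 * (n - 1) \<le> sum_list d"
    using realizes_connected_sum[OF fV R] connected_rtrancl[OF G(1)] G sumd by (simp add: V_def)
  ultimately show "is_partition d \<and> length d = n \<and> corank_ok 0 d
    \<and> even (sum_list d) \<and> 2 * (n - 1) \<le> sum_list d" using dp len by blast
next
  assume R: "is_partition d \<and> length d = n \<and> corank_ok 0 d
    \<and> even (sum_list d) \<and> 2 * (n - 1) \<le> sum_list d"
  let ?V = "{..<n}"
  have sd: "sum ((!) d) ?V = sum_list d" using R by (simp add: sum_list_sum_nth atLeast0LessThan)
  have Vne: "?V \<noteq> {}"
  proof
    assume "?V = {}"
    then have "0 \<notin> ?V" by simp
    then show False using n by simp
  qed
  have "\<exists>E. realizes ?V E ((!) d) \<and> ?V \<times> ?V \<subseteq> E\<^sup>*"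
  proof (rule connected_realization)
    show "erdos_gallai ?V ((!) d)" using corank_ok_imp_erdos_gallai[of d] R by simp
    show "?V \<noteq> {}" by (rule Vne)
    show "\<forall>v\<in>?V. 1 \<le> d ! v" using R by (auto simp: is_partition_def Suc_le_eq)
  qed (use n R sd in auto)
  then obtain E where E: "realizes ?V E ((!) d)" "?V \<times> ?V \<subseteq> E\<^sup>*" by blast
  define G where "G = \<lparr>pverts = ?V, parcs = E\<rparr>"
  have G: "pair_graph G" unfolding G_def by (rule realizes_pair_graph[OF _ E(1)]) simp
  have "connected (with_proj G)" using connected_rtrancl[OF G] E(2) Vne by (simp add: G_def)
  moreover have "is_degree_seq G d"
  proof -
    have "image_mset (out_degree (with_proj G)) (mset_set ?V) = image_mset ((!) d) (mset_set ?V)"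
      using E(1) by (intro image_mset_cong) (simp add: out_degree_card G_def realizes_def)
    also have "\<dots> = mset (map ((!) d) [0..<length d])" using R by (simp add: mset_set_upto_eq_mset_upto)
    also have "\<dots> = mset d" by (simp only: map_nth)
    finally show ?thesis using R by (simp add: is_degree_seq_def G_def is_partition_def)
  qed
  moreover have "card (pverts G) = n" by (simp add: G_def)
  ultimately show "d \<in> conn_deg_seqs n"
    using R G by (auto simp: conn_deg_seqs_def deg_seqs_def is_partition_def Suc_le_eq)
qed

text \<open>
  What remains of the potentially connected sequences of length \<open>l + 1\<close> with largest degree
  \<open>k + 1\<close> after removal of the first row and column.
\<close>

definition tails :: "nat \<Rightarrow> nat \<Rightarrow> nat list set" where
  "tails l k = {p \<in> box k l. corank_ok (int l - int k - 1) p
     \<and> 0 \<le> int (sum_list p) + (int k + 1 - int l) \<and> even (int (sum_list p) + (int k + 1 - int l))}"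

lemma conn_deg_seqs_hook: "conn_deg_seqs (Suc l) = (\<Union>k<l. hook k l ` tails l k)"
proof (intro set_eqI)
  fix d
  have hook: "hook k l p \<in> conn_deg_seqs (Suc l) \<longleftrightarrow> k < l \<and> p \<in> tails l k" if "p \<in> box k l" for k p
  proof -
    have "hook k l p \<in> hook k l ` box k l" using that by simp
    then have "is_partition (hook k l p)" "length (hook k l p) = Suc l" by (simp_all add: hook_image)
    moreover have "2 * l \<le> sum_list p + k + l + 1 \<longleftrightarrow> 0 \<le> int (sum_list p) + (int k + 1 - int l)"
      by linarith
    moreover have "even (sum_list p + k + l + 1) \<longleftrightarrow> even (int (sum_list p) + (int k + 1 - int l))"
      by presburger
    ultimately show ?thesis
      using that by (auto simp: conn_deg_seqs_iff corank_ok_hook sum_list_hook tails_def)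
  qed
  show "d \<in> conn_deg_seqs (Suc l) \<longleftrightarrow> d \<in> (\<Union>k<l. hook k l ` tails l k)"
  proof
    assume d: "d \<in> conn_deg_seqs (Suc l)"
    then have dp: "is_partition d" "length d = Suc l" by (simp_all add: conn_deg_seqs_iff)
    then have "0 < d ! 0" by (auto simp: is_partition_def)
    then obtain k where "d ! 0 = Suc k" by (cases "d ! 0") auto
    then have "d \<in> hook k l ` box k l" using dp by (simp add: hook_image)
    then show "d \<in> (\<Union>k<l. hook k l ` tails l k)" using hook d by auto
  next
    assume "d \<in> (\<Union>k<l. hook k l ` tails l k)"
    then show "d \<in> conn_deg_seqs (Suc l)" using hook by (auto simp: tails_def)
  qed
qed

lemma card_conn_deg_seqs_tails: "card (conn_deg_seqs (Suc l)) = (\<Sum>k<l. card (tails l k))"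
proof -
  have fin: "finite (tails l k)" for k by (simp add: tails_def finite_box)
  have "hook k l ` tails l k \<inter> hook k' l ` tails l k' = {}" if "k \<noteq> k'" for k k'
    using that by (auto simp: hook_def)
  then have "card (conn_deg_seqs (Suc l)) = (\<Sum>k<l. card (hook k l ` tails l k))"
    unfolding conn_deg_seqs_hook using fin by (intro card_UN_disjoint) auto
  also have "\<dots> = (\<Sum>k<l. card (tails l k))"
    by (intro sum.cong card_image inj_on_subset[OF inj_on_hook]) (auto simp: tails_def)
  finally show ?thesis .
qed

lemma card_conn_deg_seqs_tail_count:
  "int (card (conn_deg_seqs (Suc l))) = (\<Sum>k<l. tail_count (int k + 1 - int l) k l (int l - int k - 1))"
  unfolding card_conn_deg_seqs_tails of_nat_sum
  by (intro sum.cong) (auto simp: tail_count_def tails_def)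

lemma card_tails_partitions:
  assumes "k < l"
  shows "card (tails l k) = (\<Sum>N\<in>edge_sums (Suc l).
    card (partitions_in_corank (N - (int k + 1) - int l) (int k) (int l) (int l - int k - 1)))"
proof -
  let ?g = "\<lambda>p. int (sum_list p) + int k + int l + 1"
  have fin: "finite (tails l k)" by (simp add: tails_def finite_box)
  have "finite (edge_sums (Suc l))"
    by (rule finite_subset[of _ "{2 * (int (Suc l) - 1)..int (Suc l) * (int (Suc l) - 1)}"])
       (auto simp: edge_sums_def)
  moreover have "?g ` tails l k \<subseteq> edge_sums (Suc l)"
  proof
    fix N assume "N \<in> ?g ` tails l k"
    then obtain p where p: "p \<in> tails l k" "N = ?g p" by auto
    then have b: "length p \<le> l" "\<And>x. x \<in> set p \<Longrightarrow> x \<le> k" by (auto simp: tails_def box_def)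
    have "sum_list p \<le> length p * k" using b(2) by (induction p) (auto intro: add_mono)
    also have "\<dots> \<le> l * k" using b(1) by simp
    finally have "sum_list p + k + l + 1 \<le> Suc l * Suc k" by simp
    also have "\<dots> \<le> Suc l * l" using assms by (intro mult_le_mono) auto
    finally have "int (sum_list p + k + l + 1) \<le> int (Suc l * l)" by (simp only: of_nat_le_iff)
    then have "N \<le> int (Suc l) * (int (Suc l) - 1)" using p(2) by (simp add: algebra_simps)
    moreover have "even N" using p by (auto simp: tails_def)
    moreover have "2 * (int (Suc l) - 1) \<le> N" using p by (auto simp: tails_def)
    ultimately show "N \<in> edge_sums (Suc l)" unfolding edge_sums_def by simp
  qed
  ultimately have "card (tails l k) = (\<Sum>N\<in>edge_sums (Suc l). card {p \<in> tails l k. ?g p = N})"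
    using sum.group[OF fin, of "edge_sums (Suc l)" ?g "\<lambda>_. 1 :: nat"] by simp
  also have "\<dots> = (\<Sum>N\<in>edge_sums (Suc l).
      card (partitions_in_corank (N - (int k + 1) - int l) (int k) (int l) (int l - int k - 1)))"
  proof (intro sum.cong refl arg_cong[of _ _ card])
    fix N assume "N \<in> edge_sums (Suc l)"
    then have "2 * int l \<le> N" "even N" by (simp_all add: edge_sums_def)
    have "(0 \<le> int m + (int k + 1 - int l) \<and> even (int m + (int k + 1 - int l)))"
      if "int m + int k + int l + 1 = N" for m
    proof
      show "0 \<le> int m + (int k + 1 - int l)" using that \<open>2 * int l \<le> N\<close> by simp
      show "even (int m + (int k + 1 - int l))" using that \<open>even N\<close> by presburger
    qed
    then show "{p \<in> tails l k. ?g p = N}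
        = partitions_in_corank (N - (int k + 1) - int l) (int k) (int l) (int l - int k - 1)"
      using assms \<open>2 * int l \<le> N\<close>
      by (auto simp: tails_def partitions_in_corank_def partitions_in_def box_def corank_ok_def)
  qed
  finally show ?thesis .
qed

theorem card_conn_deg_seqs:
  assumes "1 \<le> n"
  shows "card (conn_deg_seqs n) = (\<Sum>N\<in>edge_sums n. \<Sum>k\<in>{1..int n - 1}.
    card (partitions_in_corank (N - k - int n + 1) (k - 1) (int n - 1) (int n - k - 1)))"
proof -
  obtain l where n: "n = Suc l" using assms by (cases n) auto
  let ?f = "\<lambda>N k. card (partitions_in_corank (N - k - int l) (k - 1) (int l) (int l - k))"
  have "card (conn_deg_seqs n) = (\<Sum>k<l. \<Sum>N\<in>edge_sums n. ?f N (int k + 1))"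
    unfolding n card_conn_deg_seqs_tails
    by (intro sum.cong refl) (simp add: card_tails_partitions algebra_simps)
  also have "\<dots> = (\<Sum>N\<in>edge_sums n. \<Sum>k<l. ?f N (int k + 1))" by (rule sum.swap)
  also have "\<dots> = (\<Sum>N\<in>edge_sums n. \<Sum>k\<in>{1..int l}. ?f N k)"
    by (intro sum.cong refl
          sum.reindex_bij_witness[of _ "\<lambda>k. nat (k - 1)" "\<lambda>k. int k + 1"]) auto
  finally show ?thesis by (simp add: n algebra_simps)
qed

section \<open>Programs within time bounds\<close>

lemma card_UN_cells_le:
  "(\<And>e. e \<in> set es \<Longrightarrow> card (cells \<sigma> e) \<le> ops e) \<Longrightarrow> card (\<Union>e\<in>set es. cells \<sigma> e) \<le> sum_list (map ops es)"
proof (induction es)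
  case (Cons e es)
  have "card (\<Union>f\<in>set (e # es). cells \<sigma> f) \<le> card (cells \<sigma> e) + card (\<Union>f\<in>set es. cells \<sigma> f)"
    by (simp add: card_Un_le)
  also have "\<dots> \<le> ops e + sum_list (map ops es)" using Cons by (intro add_mono) auto
  finally show ?case by simp
qed simp

lemma card_cells_le_ops: "card (cells \<sigma> e) \<le> ops e"
proof (induction e)
  case (Get a es)
  then have "card (\<Union>e\<in>set es. cells \<sigma> e) \<le> sum_list (map ops es)" by (rule card_UN_cells_le)
  then show ?case
    using card_insert_le_m1[of "Suc (sum_list (map ops es))" "\<Union>e\<in>set es. cells \<sigma> e"] by simp
qed (auto intro: order_trans[OF card_Un_le] add_mono)

lemma card_test_cells_le_ops: "card (test_cells \<sigma> b) \<le> test_ops b"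
  by (cases b) (auto intro: order_trans[OF card_Un_le] add_mono card_cells_le_ops le_SucI)

text \<open>
  Every read or write of a cell is charged one unit of time.
\<close>

lemma exec_card_le_time: "exec c \<sigma> t M \<sigma>' \<Longrightarrow> card M \<le> t"
proof (induction rule: exec.induct)
  case (Put x a \<sigma> es e)
  let ?F = "(\<Union>f\<in>set es. cells \<sigma> f) \<union> cells \<sigma> e"
  have "card (insert x ?F) \<le> Suc (card ?F)" by (simp add: card_insert_le_m1)
  also have "card ?F \<le> sum_list (map ops es) + ops e"
    using card_Un_le[of "\<Union>f\<in>set es. cells \<sigma> f" "cells \<sigma> e"] card_UN_cells_le[of es \<sigma>]
      card_cells_le_ops[of \<sigma>] by (meson add_mono order_trans)
  finally show ?case by simp
next
  case (Seq c \<sigma> t M \<sigma>' d u L \<sigma>'')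
  then show ?case using card_Un_le[of M L] by linarith
next
  case (IfTrue \<sigma> b c t M \<sigma>' d)
  then show ?case using card_Un_le[of "test_cells \<sigma> b" M] card_test_cells_le_ops[of \<sigma> b] by linarith
next
  case (IfFalse \<sigma> b d t M \<sigma>' c)
  then show ?case using card_Un_le[of "test_cells \<sigma> b" M] card_test_cells_le_ops[of \<sigma> b] by linarith
next
  case (WhileFalse \<sigma> b c)
  show ?case by (rule card_test_cells_le_ops)
next
  case (WhileTrue \<sigma> b c t M \<sigma>' u L \<sigma>'')
  then show ?case
    using card_Un_le[of "test_cells \<sigma> b \<union> M" L] card_Un_le[of "test_cells \<sigma> b" M]
      card_test_cells_le_ops[of \<sigma> b] by linarith
qed simp

text \<open>
  Hoare triples for total correctness with an upper bound on the running time.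
\<close>

definition run :: "(store \<Rightarrow> bool) \<Rightarrow> com \<Rightarrow> (store \<Rightarrow> bool) \<Rightarrow> nat \<Rightarrow> bool" where
  "run P c Q t \<longleftrightarrow> (\<forall>\<sigma>. P \<sigma> \<longrightarrow> (\<exists>u M \<sigma>'. exec c \<sigma> u M \<sigma>' \<and> u \<le> t \<and> Q \<sigma>'))"

lemma run_Put:
  assumes "\<And>\<sigma>. P \<sigma> \<Longrightarrow> Q (\<sigma>((a, map (val \<sigma>) es) := val \<sigma> e))"
    and "1 + sum_list (map ops es) + ops e \<le> t"
  shows "run P (Put a es e) Q t"
  unfolding run_def using assms exec.Put[OF refl] by blast

lemma run_Seq:
  assumes "run P c Q t" "run Q d R u" "t + u \<le> w"
  shows "run P (Seq c d) R w"
  unfolding run_def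
proof (intro allI impI)
  fix \<sigma> assume "P \<sigma>"
  then obtain t' M \<sigma>' where 1: "exec c \<sigma> t' M \<sigma>'" "t' \<le> t" "Q \<sigma>'" using assms(1) by (auto simp: run_def)
  then obtain u' L \<sigma>'' where 2: "exec d \<sigma>' u' L \<sigma>''" "u' \<le> u" "R \<sigma>''" using assms(2) by (auto simp: run_def)
  show "\<exists>u M \<sigma>'. exec (Seq c d) \<sigma> u M \<sigma>' \<and> u \<le> w \<and> R \<sigma>'"
    using exec.Seq[OF 1(1) 2(1)] 1(2) 2(2,3) assms(3) by (meson add_mono order_trans)
qed

lemma run_If:
  assumes "run (\<lambda>\<sigma>. P \<sigma> \<and> test_val \<sigma> b) c Q t" "run (\<lambda>\<sigma>. P \<sigma> \<and> \<not> test_val \<sigma> b) d Q t"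
    and "test_ops b + t \<le> w"
  shows "run P (If b c d) Q w"
  unfolding run_def
proof (intro allI impI)
  fix \<sigma> assume P: "P \<sigma>"
  show "\<exists>u M \<sigma>'. exec (If b c d) \<sigma> u M \<sigma>' \<and> u \<le> w \<and> Q \<sigma>'"
  proof (cases "test_val \<sigma> b")
    case True
    then obtain u M \<sigma>' where "exec c \<sigma> u M \<sigma>'" "u \<le> t" "Q \<sigma>'" using assms(1) P by (auto simp: run_def)
    then show ?thesis using exec.IfTrue[OF True, of c u M \<sigma>' d] assms(3)
      by (intro exI[of _ "test_ops b + u"] exI conjI) auto
  next
    case False
    then obtain u M \<sigma>' where "exec d \<sigma> u M \<sigma>'" "u \<le> t" "Q \<sigma>'" using assms(2) P by (auto simp: run_def)
    then show ?thesis using exec.IfFalse[OF False, of d u M \<sigma>' c] assms(3)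
      by (intro exI[of _ "test_ops b + u"] exI conjI) auto
  qed
qed

lemma run_conseq:
  assumes "run P c Q t" "\<And>\<sigma>. P' \<sigma> \<Longrightarrow> P \<sigma>" "\<And>\<sigma>. Q \<sigma> \<Longrightarrow> Q' \<sigma>" "t \<le> t'"
  shows "run P' c Q' t'"
  using assms unfolding run_def by (meson order_trans)

definition For :: "nat \<Rightarrow> exp \<Rightarrow> exp \<Rightarrow> com \<Rightarrow> com" where
  "For v lo hi c = Seq (Put v [] lo)
     (While (Less (Get v []) hi) (Seq c (Put v [] (Add (Get v []) (Const 1)))))"

text \<open>
  The invariant must not depend on the loop variable, which is tracked separately.  An iteration
  costs, besides the body, \<open>2 + ops ehi\<close> units for the test and 3 for the increment.
\<close>

lemma run_For:
  fixes I :: "int \<Rightarrow> store \<Rightarrow> bool"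
  assumes lohi: "lo \<le> hi"
    and init: "\<And>\<sigma>. P \<sigma> \<Longrightarrow> val \<sigma> elo = lo \<and> I lo \<sigma>"
    and upd: "\<And>i \<sigma> y. I i \<sigma> \<Longrightarrow> I i (\<sigma>((v, []) := y))"
    and bound: "\<And>i \<sigma>. I i \<sigma> \<Longrightarrow> val \<sigma> ehi = hi"
    and body: "\<And>i. lo \<le> i \<Longrightarrow> i < hi \<Longrightarrow>
      run (\<lambda>\<sigma>. I i \<sigma> \<and> \<sigma> (v, []) = i) c (\<lambda>\<sigma>. I (i + 1) \<sigma> \<and> \<sigma> (v, []) = i) t"
    and time: "nat (hi - lo) * (t + ops ehi + 5) + ops elo + ops ehi + 3 \<le> w"
  shows "run P (For v elo ehi c) (I hi) w"
proof -
  let ?W = "While (Less (Get v []) ehi) (Seq c (Put v [] (Add (Get v []) (Const 1))))"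
  let ?T = "\<lambda>m. m * (t + ops ehi + 5) + ops ehi + 2"
  have loop: "\<exists>u M \<sigma>'. exec ?W \<sigma> u M \<sigma>' \<and> u \<le> ?T m \<and> I hi \<sigma>'"
    if "I i \<sigma>" "\<sigma> (v, []) = i" "lo \<le> i" "i \<le> hi" "m = nat (hi - i)" for m i \<sigma>
    using that
  proof (induction m arbitrary: i \<sigma>)
    case 0
    then have "i = hi" by simp
    then have "\<not> test_val \<sigma> (Less (Get v []) ehi)" using 0 bound[of i \<sigma>] by simp
    then have "exec ?W \<sigma> (ops ehi + 2) (test_cells \<sigma> (Less (Get v []) ehi)) \<sigma>"
      using exec.WhileFalse[of \<sigma> "Less (Get v []) ehi"] by simp
    then show ?case using 0 \<open>i = hi\<close> by force
  next
    case (Suc m)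
    then have ihi: "i < hi" by simp
    have test: "test_val \<sigma> (Less (Get v []) ehi)" using Suc.prems ihi bound[of i \<sigma>] by simp
    obtain u M \<sigma>' where 1: "exec c \<sigma> u M \<sigma>'" "u \<le> t" "I (i + 1) \<sigma>'" "\<sigma>' (v, []) = i"
      using body[OF Suc.prems(3) ihi] Suc.prems by (auto simp: run_def)
    let ?\<sigma> = "\<sigma>'((v, []) := val \<sigma>' (Add (Get v []) (Const 1)))"
    have 2: "exec (Put v [] (Add (Get v []) (Const 1))) \<sigma>' 3
        (insert (v, []) {(v, [])}) ?\<sigma>"
      using exec.Put[of "(v, [])" v \<sigma>' "[]" "Add (Get v []) (Const 1)"] by (simp add: numeral_3_eq_3)
    have "I (i + 1) ?\<sigma>" "?\<sigma> (v, []) = i + 1" "lo \<le> i + 1" "i + 1 \<le> hi" "m = nat (hi - (i + 1))"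
      using upd[OF 1(3)] 1(4) Suc.prems ihi by auto
    then obtain u' M' \<sigma>'' where 3: "exec ?W ?\<sigma> u' M' \<sigma>''" "u' \<le> ?T m" "I hi \<sigma>''"
      using Suc.IH by blast
    show ?case
    proof (intro exI conjI)
      show "I hi \<sigma>''" by (rule 3(3))
    qed (rule exec.WhileTrue[OF test exec.Seq[OF 1(1) 2] 3(1)], use 1(2) 3(2) in simp)
  qed
  show ?thesis
    unfolding run_def For_def
  proof (intro allI impI)
    fix \<sigma> assume "P \<sigma>"
    then have i: "val \<sigma> elo = lo" "I lo \<sigma>" using init by auto
    obtain u M \<sigma>' where 1: "exec ?W (\<sigma>((v, []) := lo)) u M \<sigma>'" "u \<le> ?T (nat (hi - lo))" "I hi \<sigma>'"
      using loop[of lo "\<sigma>((v, []) := lo)"] upd[OF i(2)] lohi by auto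
    have 2: "exec (Put v [] elo) \<sigma> (1 + ops elo) (insert (v, []) (cells \<sigma> elo)) (\<sigma>((v, []) := lo))"
      using exec.Put[of "(v, [])" v \<sigma> "[]" elo] i(1) by simp
    show "\<exists>u M \<sigma>'. exec (Seq (Put v [] elo) ?W) \<sigma> u M \<sigma>' \<and> u \<le> w \<and> I hi \<sigma>'"
    proof (intro exI conjI)
      show "I hi \<sigma>'" by (rule 1(3))
    qed (rule exec.Seq[OF 2 1(1)], use 1(2) time in simp)
  qed
qed

section \<open>The counting program\<close>

abbreviation "vn \<equiv> Get 0 []"
abbreviation "vr \<equiv> Get 1 []"
abbreviation "vk \<equiv> Get 3 []"
abbreviation "vl \<equiv> Get 4 []"
abbreviation "vs \<equiv> Get 5 []"
abbreviation "vx \<equiv> Get 6 []"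
abbreviation "vb \<equiv> Get 7 []"
abbreviation "tab x k l s \<equiv> Get 2 [x, k, l, s]"

text \<open>
  One entry of the table.  For \<open>k\<close> or \<open>l\<close> equal to 0 only the empty partition is counted.
  Entries with negative \<open>s\<close> are never written, so the last term of the recurrence reads the correct
  value 0 without a test.
\<close>

definition cell_step :: com where
  "cell_step =
    If (Less (Const 0) vx) (Put 2 [vx, vk, vl, vs] (tab (Sub vx (Const 2)) vk vl vs))
   (If (Equal vk (Const 0))
     (If (Equal vx (Const 0)) (Put 2 [vx, vk, vl, vs] (Const 1)) (Put 2 [vx, vk, vl, vs] (Const 0)))
   (If (Equal vl (Const 0))
     (If (Equal vx (Const 0)) (Put 2 [vx, vk, vl, vs] (Const 1)) (Put 2 [vx, vk, vl, vs] (Const 0)))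
     (Put 2 [vx, vk, vl, vs]
       (Add (Sub (Add (tab vx (Sub vk (Const 1)) vl vs) (tab vx vk (Sub vl (Const 1)) vs))
                 (tab vx (Sub vk (Const 1)) (Sub vl (Const 1)) vs))
            (tab (Sub (Add (Add vx vk) vl) (Const 1)) (Sub vk (Const 1)) (Sub vl (Const 1))
               (Sub (Sub (Add vs vl) vk) (Const 1)))))))"

text \<open>
  The first loop computes \<open>n * n\<close> in \<open>vb\<close>, for want of multiplication.  The last one adds up the entries
  that belong to the possible values \<open>k + 1\<close> of the largest degree.
\<close>

definition count_prog :: com where
  "count_prog =
    Seq (For 3 (Const 0) vn (Put 7 [] (Add vb vn)))
   (Seq (For 3 (Const 0) vn (For 4 (Const 0) vn (For 5 (Const 0) vb
          (For 6 (Sub (Const 0) vn) (Add vn vn) cell_step))))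
        (For 3 (Const 0) (Sub vn (Const 1))
          (Put 1 [] (Add vr (tab (Sub (Add vk (Const 2)) vn) vk (Sub vn (Const 1))
             (Sub (Sub vn (Const 2)) vk))))))"

text \<open>
  The recurrence at \<open>(k, l, s)\<close> refers to \<open>(k - 1, l - 1, s + l - k - 1)\<close>, so entries with
  \<open>s\<close> close to the bound \<open>n * n\<close> may be computed from cells outside the table and be wrong.  As
  \<open>s\<close> grows by less than \<open>n\<close> whenever \<open>l\<close> drops by one, the entries with \<open>s + n * l < n * n\<close>
  depend on entries of the same kind only, and they include all those needed in the end.
\<close>

definition reliable :: "int \<Rightarrow> int \<Rightarrow> int \<Rightarrow> int \<Rightarrow> int \<Rightarrow> bool" where
  "reliable n x k l s \<longleftrightarrow> - n \<le> x \<and> x < 2 * n \<and> 0 \<le> k \<and> k < n \<and> 0 \<le> l \<and> l < n \<and> 0 \<le> s \<and> s + n * l < n * n"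

text \<open>
  The invariant common to all loops: the reliable entries that precede \<open>(k0, l0, s0, x0)\<close> in the
  lexicographic order, in which the nested loops visit them, are correct.
\<close>

definition table_ok :: "int \<Rightarrow> int \<Rightarrow> int \<Rightarrow> int \<Rightarrow> int \<Rightarrow> int \<Rightarrow> store \<Rightarrow> bool" where
  "table_ok n r k0 l0 s0 x0 \<sigma> \<longleftrightarrow> \<sigma> (0, []) = n \<and> \<sigma> (7, []) = n * n \<and> \<sigma> (1, []) = r
    \<and> (\<forall>x k l s. s < 0 \<longrightarrow> \<sigma> (2, [x, k, l, s]) = 0)
    \<and> (\<forall>x k l s. reliable n x k l s \<and>
         (k < k0 \<or> k = k0 \<and> (l < l0 \<or> l = l0 \<and> (s < s0 \<or> s = s0 \<and> x < x0)))
         \<longrightarrow> \<sigma> (2, [x, k, l, s]) = tail_count x (nat k) (nat l) s)"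

lemma table_lookup:
  assumes "table_ok n r k0 l0 s0 x0 \<sigma>" "reliable n x k l s"
    and "k < k0 \<or> k = k0 \<and> (l < l0 \<or> l = l0 \<and> (s < s0 \<or> s = s0 \<and> x < x0))"
  shows "\<sigma> (2, [x, k, l, s]) = tail_count x (nat k) (nat l) s"
  using assms by (simp add: table_ok_def)

lemma table_neg: "table_ok n r k0 l0 s0 x0 \<sigma> \<Longrightarrow> s < 0 \<Longrightarrow> \<sigma> (2, [x, k, l, s]) = 0"
  by (simp add: table_ok_def)

lemma table_advance:
  assumes "table_ok n r k0 l0 s0 x0 \<sigma>"
    and "\<And>x k l s. reliable n x k l s \<Longrightarrow>
      k < k1 \<or> k = k1 \<and> (l < l1 \<or> l = l1 \<and> (s < s1 \<or> s = s1 \<and> x < x1)) \<Longrightarrow>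
      k < k0 \<or> k = k0 \<and> (l < l0 \<or> l = l0 \<and> (s < s0 \<or> s = s0 \<and> x < x0))"
  shows "table_ok n r k1 l1 s1 x1 \<sigma>"
  using assms unfolding table_ok_def by blast

lemma reliable_less_square: "reliable n x k l s \<Longrightarrow> s < n * n"
proof -
  assume v: "reliable n x k l s"
  then have "0 \<le> n * l" by (intro mult_nonneg_nonneg) (auto simp: reliable_def)
  moreover have "s + n * l < n * n" using v by (simp add: reliable_def)
  ultimately show "s < n * n" by linarith
qed

lemma table_update:
  assumes "table_ok n r k l s x \<sigma>" "0 \<le> s"
    and "reliable n x k l s \<Longrightarrow> w = tail_count x (nat k) (nat l) s"
  shows "table_ok n r k l s (x + 1) (\<sigma>((2, [x, k, l, s]) := w))"
  using assms unfolding table_ok_def by (auto simp: less_le)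

lemma table_fill:
  assumes "table_ok n r k l s x \<sigma>" "0 \<le> s"
    and "\<sigma> (3, []) = k" "\<sigma> (4, []) = l" "\<sigma> (5, []) = s" "\<sigma> (6, []) = x"
    and "reliable n x k l s \<Longrightarrow> w = tail_count x (nat k) (nat l) s"
  defines "\<sigma>' \<equiv> \<sigma>((2, [x, k, l, s]) := w)"
  shows "((table_ok n r k l s (x + 1) \<sigma>' \<and> \<sigma>' (3, []) = k \<and> \<sigma>' (4, []) = l) \<and> \<sigma>' (5, []) = s) \<and> \<sigma>' (6, []) = x"
  using table_update[OF assms(1,2,7)] assms by simp

lemma table_recurrence:
  assumes T: "table_ok n r k l s x \<sigma>" and v: "reliable n x k l s" and "x \<le> 0" "k \<noteq> 0" "l \<noteq> 0"
  shows "\<sigma> (2, [x, k - 1, l, s]) + \<sigma> (2, [x, k, l - 1, s]) - \<sigma> (2, [x, k - 1, l - 1, s])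
    + \<sigma> (2, [x + k + l - 1, k - 1, l - 1, s + l - k - 1]) = tail_count x (nat k) (nat l) s"
proof -
  have b: "- n \<le> x" "x < 2 * n" "1 \<le> k" "k < n" "1 \<le> l" "l < n" "0 \<le> s" "s + n * l < n * n"
    using v assms(4,5) by (auto simp: reliable_def)
  define i j where "i = nat (k - 1)" and "j = nat (l - 1)"
  have kl: "k = int i + 1" "l = int j + 1" using b by (auto simp: i_def j_def)
  have nn: "nat k = Suc i" "nat l = Suc j" "nat (k - 1) = i" "nat (l - 1) = j" using kl by auto
  have nl: "n * (l - 1) = n * l - n" by (simp add: algebra_simps)
  have e: "x + k + l - 1 = x + int i + int j + 1" "s + l - k - 1 = s + int j - int i - 1"
    using kl by simp_all
  have 1: "\<sigma> (2, [x, k - 1, l, s]) = tail_count x i (Suc j) s"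
    using table_lookup[OF T, of x "k - 1" l s] b nn by (simp add: reliable_def)
  have 2: "\<sigma> (2, [x, k, l - 1, s]) = tail_count x (Suc i) j s"
    using table_lookup[OF T, of x k "l - 1" s] b nn nl by (simp add: reliable_def)
  have 3: "\<sigma> (2, [x, k - 1, l - 1, s]) = tail_count x i j s"
    using table_lookup[OF T, of x "k - 1" "l - 1" s] b nn nl by (simp add: reliable_def)
  have 4: "\<sigma> (2, [x + k + l - 1, k - 1, l - 1, s + l - k - 1])
      = tail_count (x + k + l - 1) i j (s + l - k - 1)"
  proof (cases "s + l - k - 1 < 0")
    case True
    then show ?thesis using table_neg[OF T] by (simp add: tail_count_neg)
  next
    case False
    then show ?thesis
      using table_lookup[OF T, of "x + k + l - 1" "k - 1" "l - 1" "s + l - k - 1"] b nn nl assms(3)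
      by (simp add: reliable_def)
  qed
  show ?thesis unfolding 1 2 3 4 unfolding e nn tail_count_rec[OF b(7)] ..
qed

lemma run_cell_step:
  assumes "0 < n" "0 \<le> s"
  shows "run (\<lambda>\<sigma>. ((table_ok n r k l s x \<sigma> \<and> \<sigma> (3, []) = k \<and> \<sigma> (4, []) = l) \<and> \<sigma> (5, []) = s) \<and> \<sigma> (6, []) = x)
    cell_step
    (\<lambda>\<sigma>. ((table_ok n r k l s (x + 1) \<sigma> \<and> \<sigma> (3, []) = k \<and> \<sigma> (4, []) = l) \<and> \<sigma> (5, []) = s) \<and> \<sigma> (6, []) = x)
    60"
    (is "run (?P x) cell_step ?Q _")
proof -
  have put: "run R (Put 2 [vx, vk, vl, vs] e) ?Q t"
    if "ops e + 5 \<le> t" "\<And>\<sigma>. R \<sigma> \<Longrightarrow> ?P x \<sigma>"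
      "\<And>\<sigma>. R \<sigma> \<Longrightarrow> reliable n x k l s \<Longrightarrow> val \<sigma> e = tail_count x (nat k) (nat l) s" for R e t
  proof (rule run_Put)
    fix \<sigma> assume R: "R \<sigma>"
    then have P: "?P x \<sigma>" by (rule that(2))
    show "?Q (\<sigma>((2, map (val \<sigma>) [vx, vk, vl, vs]) := val \<sigma> e))"
      using table_fill[of n r k l s x \<sigma> "val \<sigma> e"] P that(3)[OF R] assms by simp
  qed (use that(1) in simp)
  have base: "run R (If (Equal vx (Const 0)) (Put 2 [vx, vk, vl, vs] (Const 1)) (Put 2 [vx, vk, vl, vs] (Const 0))) ?Q 8"
    if R: "\<And>\<sigma>. R \<sigma> \<Longrightarrow> ?P x \<sigma>" and "x \<le> 0" "k = 0 \<or> l = 0" for R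
  proof (rule run_If[where t = 5])
    have "nat k = 0 \<or> nat l = 0" using that(3) by auto
    note b = tail_count_base[OF this assms(2)]
    show "run (\<lambda>\<sigma>. R \<sigma> \<and> test_val \<sigma> (Equal vx (Const 0))) (Put 2 [vx, vk, vl, vs] (Const 1)) ?Q 5"
      by (rule put) (use R b in auto)
    show "run (\<lambda>\<sigma>. R \<sigma> \<and> \<not> test_val \<sigma> (Equal vx (Const 0))) (Put 2 [vx, vk, vl, vs] (Const 0)) ?Q 5"
    proof (rule put)
      fix \<sigma> assume "R \<sigma> \<and> \<not> test_val \<sigma> (Equal vx (Const 0))"
      then have "x < 0" using R that(2) by force
      then show "val \<sigma> (Const 0) = tail_count x (nat k) (nat l) s" using b by simp
    qed (use R in auto)
  qed simp
  show ?thesis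
    unfolding cell_step_def
  proof (rule run_If[where t = 57], goal_cases)
    case 1
    show ?case
    proof (rule put)
      fix \<sigma> assume "?P x \<sigma> \<and> test_val \<sigma> (Less (Const 0) vx)" and v: "reliable n x k l s"
      then have P: "?P x \<sigma>" and "0 < x" by auto
      then have "\<sigma> (2, [x - 2, k, l, s]) = tail_count (x - 2) (nat k) (nat l) s"
        using v assms by (intro table_lookup[of n r k l s x]) (auto simp: reliable_def)
      then show "val \<sigma> (tab (Sub vx (Const 2)) vk vl vs) = tail_count x (nat k) (nat l) s"
        using P tail_count_pos_shift[OF \<open>0 < x\<close>] by simp
    qed auto
  next
    case 2
    show ?case
    proof (cases "0 < x")
      case True
      then show ?thesis by (auto simp: run_def)
    next
      case False
      show ?thesis
      proof (rule run_If[where t = 54], goal_cases)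
        case 1
        show ?case
        proof (cases "k = 0")
          case True
          show ?thesis by (rule run_conseq[OF base[of "?P x"]]) (use True False in auto)
        qed (auto simp: run_def)
      next
        case 2
        show ?case
        proof (rule run_If[where t = 51], goal_cases)
          case 1
          show ?case
          proof (cases "l = 0")
            case True
            show ?thesis by (rule run_conseq[OF base[of "?P x"]]) (use True False in auto)
          qed (auto simp: run_def)
        next
          case 2
          show ?case
          proof (rule put, goal_cases)
            case (3 \<sigma>)
            then show ?case
              using table_recurrence[of n r k l s x \<sigma>] False by auto
          qed auto
        qed simp
      qed simp
    qed
  qed simp
qed


text \<open>
  The nested loops over \<open>x\<close>, \<open>s\<close>, \<open>l\<close>, \<open>k\<close> multiply the time of an entry by \<open>3 * n\<close>, \<open>n * n\<close>,
  \<open>n\<close> and \<open>n\<close>; the constants are generous enough to absorb the cost of running each loop.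
\<close>

lemma run_count_prog:
  assumes "1 \<le> n"
  shows "run (\<lambda>\<sigma>. \<sigma> = input_store n) count_prog
    (\<lambda>\<sigma>. \<sigma> (1, []) = (\<Sum>k<n - 1. tail_count (int k + 1 - int (n - 1)) k (n - 1) (int (n - 1) - int k - 1)))
    (1000 * n ^ 5)"
proof -
  define m where "m = int n"
  have m: "0 < m" "nat m = n" using assms by (auto simp: m_def)
  define l where "l = n - 1"
  have lm: "int l = m - 1" using assms by (simp add: l_def m_def)
  define res where "res = (\<lambda>k. \<Sum>j<nat k. tail_count (int j + 1 - int l) j l (int l - int j - 1))"
  have pw: "1 \<le> n ^ j" for j using assms by simp
  have x_loop: "run (\<lambda>\<sigma>. ((table_ok m 0 k l s (- m) \<sigma> \<and> \<sigma> (3, []) = k \<and> \<sigma> (4, []) = l) \<and> \<sigma> (5, []) = s))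
      (For 6 (Sub (Const 0) vn) (Add vn vn) cell_step)
      (\<lambda>\<sigma>. (table_ok m 0 k l (s + 1) (- m) \<sigma> \<and> \<sigma> (3, []) = k \<and> \<sigma> (4, []) = l) \<and> \<sigma> (5, []) = s) (300 * n)"
    if "0 \<le> s" for k l s
  proof (rule run_conseq)
    show "run (\<lambda>\<sigma>. ((table_ok m 0 k l s (- m) \<sigma> \<and> \<sigma> (3, []) = k \<and> \<sigma> (4, []) = l) \<and> \<sigma> (5, []) = s))
      (For 6 (Sub (Const 0) vn) (Add vn vn) cell_step)
      (\<lambda>\<sigma>. (table_ok m 0 k l s (2 * m) \<sigma> \<and> \<sigma> (3, []) = k \<and> \<sigma> (4, []) = l) \<and> \<sigma> (5, []) = s) (300 * n)"
    proof (rule run_For[where lo = "- m" and t = 60 and I = "\<lambda>i \<sigma>. (table_ok m 0 k l s i \<sigma> \<and> \<sigma> (3, []) = k \<and> \<sigma> (4, []) = l) \<and> \<sigma> (5, []) = s"], goal_cases)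
      case (5 i)
      show ?case using run_cell_step[OF m(1) that] by simp
    next
      case 6
      have "nat (2 * m - - m) = 3 * n" by (simp add: m_def)
      then show ?case using assms by simp
    qed (use m in \<open>auto simp: table_ok_def\<close>)
    show "(table_ok m 0 k l (s + 1) (- m) \<sigma> \<and> \<sigma> (3, []) = k \<and> \<sigma> (4, []) = l) \<and> \<sigma> (5, []) = s"
      if "(table_ok m 0 k l s (2 * m) \<sigma> \<and> \<sigma> (3, []) = k \<and> \<sigma> (4, []) = l) \<and> \<sigma> (5, []) = s" for \<sigma>
      using that by (auto intro: table_advance simp: reliable_def)
  qed auto
  have s_loop: "run (\<lambda>\<sigma>. (table_ok m 0 k l 0 (- m) \<sigma> \<and> \<sigma> (3, []) = k) \<and> \<sigma> (4, []) = l)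
      (For 5 (Const 0) vb (For 6 (Sub (Const 0) vn) (Add vn vn) cell_step))
      (\<lambda>\<sigma>. (table_ok m 0 k (l + 1) 0 (- m) \<sigma> \<and> \<sigma> (3, []) = k) \<and> \<sigma> (4, []) = l) (340 * n ^ 3)" if "0 \<le> l" for k l
  proof (rule run_conseq)
    show "run (\<lambda>\<sigma>. (table_ok m 0 k l 0 (- m) \<sigma> \<and> \<sigma> (3, []) = k) \<and> \<sigma> (4, []) = l)
      (For 5 (Const 0) vb (For 6 (Sub (Const 0) vn) (Add vn vn) cell_step))
      (\<lambda>\<sigma>. table_ok m 0 k l (m * m) (- m) \<sigma> \<and> \<sigma> (3, []) = k \<and> \<sigma> (4, []) = l) (340 * n ^ 3)"
    proof (rule run_For[where lo = 0 and t = "300 * n" and I = "\<lambda>i \<sigma>. table_ok m 0 k l i (- m) \<sigma> \<and> \<sigma> (3, []) = k \<and> \<sigma> (4, []) = l"], goal_cases)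
      case (5 i)
      then show ?case using x_loop[of i k l] by simp
    next
      case 6
      have "nat (m * m - 0) = n * n" by (simp add: m_def nat_mult_distrib)
      moreover have "n * n * (300 * n + 6) + 4 \<le> 340 * n ^ 3"
      proof -
        have "n * n \<le> n ^ 3" using assms by (simp add: power3_eq_cube)
        moreover have "n * n * (300 * n + 6) = 300 * n ^ 3 + 6 * (n * n)"
          by (simp add: power3_eq_cube algebra_simps)
        ultimately show ?thesis using pw[of 3] by linarith
      qed
      ultimately show ?case by (simp add: ac_simps)
    qed (use m in \<open>auto simp: table_ok_def\<close>)
    show "(table_ok m 0 k (l + 1) 0 (- m) \<sigma> \<and> \<sigma> (3, []) = k) \<and> \<sigma> (4, []) = l"
      if "table_ok m 0 k l (m * m) (- m) \<sigma> \<and> \<sigma> (3, []) = k \<and> \<sigma> (4, []) = l" for \<sigma>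
      using that reliable_less_square[of m] by (fastforce intro: table_advance simp: reliable_def)
  qed auto
  have l_loop: "run (\<lambda>\<sigma>. table_ok m 0 k 0 0 (- m) \<sigma> \<and> \<sigma> (3, []) = k)
      (For 4 (Const 0) vn (For 5 (Const 0) vb (For 6 (Sub (Const 0) vn) (Add vn vn) cell_step)))
      (\<lambda>\<sigma>. table_ok m 0 (k + 1) 0 0 (- m) \<sigma> \<and> \<sigma> (3, []) = k) (400 * n ^ 4)" for k
  proof (rule run_conseq)
    show "run (\<lambda>\<sigma>. table_ok m 0 k 0 0 (- m) \<sigma> \<and> \<sigma> (3, []) = k)
      (For 4 (Const 0) vn (For 5 (Const 0) vb (For 6 (Sub (Const 0) vn) (Add vn vn) cell_step)))
      (\<lambda>\<sigma>. table_ok m 0 k m 0 (- m) \<sigma> \<and> \<sigma> (3, []) = k) (400 * n ^ 4)"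
    proof (rule run_For[where lo = 0 and t = "340 * n ^ 3" and I = "\<lambda>i \<sigma>. table_ok m 0 k i 0 (- m) \<sigma> \<and> \<sigma> (3, []) = k"], goal_cases)
      case (5 i)
      then show ?case using s_loop[of i k] by simp
    next
      case 6
      have "n \<le> n ^ 4" using assms by (intro self_le_power) auto
      moreover have "n * (340 * n ^ 3 + 6) = 340 * n ^ 4 + 6 * n"
        by (simp add: algebra_simps power_numeral_reduce)
      ultimately have "n * (340 * n ^ 3 + 6) + 4 \<le> 400 * n ^ 4" using pw[of 4] by linarith
      then show ?case using m by (simp add: ac_simps)
    qed (use m in \<open>auto simp: table_ok_def\<close>)
    show "table_ok m 0 (k + 1) 0 0 (- m) \<sigma> \<and> \<sigma> (3, []) = k"
      if "table_ok m 0 k m 0 (- m) \<sigma> \<and> \<sigma> (3, []) = k" for \<sigma>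
      using that by (auto intro: table_advance simp: reliable_def)
  qed auto
  have k_loop: "run (table_ok m 0 0 0 0 (- m))
      (For 3 (Const 0) vn (For 4 (Const 0) vn (For 5 (Const 0) vb (For 6 (Sub (Const 0) vn) (Add vn vn) cell_step))))
      (table_ok m 0 m 0 0 (- m)) (450 * n ^ 5)"
  proof (rule run_For[where lo = 0 and t = "400 * n ^ 4" and I = "\<lambda>i. table_ok m 0 i 0 0 (- m)"], goal_cases)
    case (5 i)
    show ?case using l_loop[of i] by simp
  next
    case 6
    have "n \<le> n ^ 5" using assms by (intro self_le_power) auto
    moreover have "n * (400 * n ^ 4 + 6) = 400 * n ^ 5 + 6 * n"
      by (simp add: algebra_simps power_numeral_reduce)
    ultimately have "n * (400 * n ^ 4 + 6) + 4 \<le> 450 * n ^ 5" using pw[of 5] by linarith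
    then show ?case using m by (simp add: ac_simps)
  qed (use m in \<open>auto simp: table_ok_def\<close>)
  have b_loop: "run (\<lambda>\<sigma>. \<sigma> = input_store n) (For 3 (Const 0) vn (Put 7 [] (Add vb vn)))
      (table_ok m 0 0 0 0 (- m)) (20 * n)"
  proof (rule run_conseq)
    let ?I = "\<lambda>i \<sigma>. \<sigma> (0, []) = m \<and> \<sigma> (7, []) = m * i \<and> \<sigma> (1, []) = 0 \<and> (\<forall>y. \<sigma> (2, y) = 0)"
    show "run (\<lambda>\<sigma>. \<sigma> = input_store n) (For 3 (Const 0) vn (Put 7 [] (Add vb vn))) (?I m) (20 * n)"
    proof (rule run_For[where lo = 0 and t = 4 and I = ?I], goal_cases)
      case (5 i)
      show ?case by (rule run_Put) (auto simp: algebra_simps)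
    qed (use m assms in \<open>auto simp: input_store_def m_def\<close>)
    show "table_ok m 0 0 0 0 (- m) \<sigma>" if "?I m \<sigma>" for \<sigma>
      using that by (auto simp: table_ok_def reliable_def)
  qed auto
  have sum_loop: "run (table_ok m 0 m 0 0 (- m))
     (For 3 (Const 0) (Sub vn (Const 1))
          (Put 1 [] (Add vr (tab (Sub (Add vk (Const 2)) vn) vk (Sub vn (Const 1))
             (Sub (Sub vn (Const 2)) vk)))))
     (table_ok m (res (m - 1)) m 0 0 (- m)) (50 * n)"
  proof (rule run_For[where I = "\<lambda>k. table_ok m (res k) m 0 0 (- m)" and lo = 0 and t = 30], goal_cases)
    case (5 k)
    show ?case
    proof (rule run_Put, goal_cases)
      case (1 \<sigma>)
      then have T: "table_ok m (res k) m 0 0 (- m) \<sigma>" and k: "\<sigma> (3, []) = k" by auto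
      have "m - 2 - k + m * (m - 1) < m * m" using 5 by (simp add: algebra_simps)
      then have "\<sigma> (2, [k + 2 - m, k, m - 1, m - 2 - k]) = tail_count (k + 2 - m) (nat k) (nat (m - 1)) (m - 2 - k)"
        using 5 m by (intro table_lookup[OF T]) (auto simp: reliable_def)
      moreover have "nat (k + 1) = Suc (nat k)" "nat (m - 1) = l"
        "int (nat k) + 1 - int l = k + 2 - m" "int l - int (nat k) - 1 = m - 2 - k"
        using 5 lm by auto
      ultimately have "res (k + 1) = res k + \<sigma> (2, [k + 2 - m, k, m - 1, m - 2 - k])"
        by (simp only: res_def sum.lessThan_Suc)
      then show ?case using T k by (simp add: table_ok_def algebra_simps)
    qed simp
  next
    case 6
    show ?case using m assms by (simp add: nat_diff_distrib)
  qed (use m in \<open>auto simp: table_ok_def res_def\<close>)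
  have "n \<le> n ^ 5" using assms by (intro self_le_power) auto
  then have "20 * n + (450 * n ^ 5 + 50 * n) \<le> 1000 * n ^ 5" by linarith
  from run_Seq[OF b_loop run_Seq[OF k_loop sum_loop order.refl] this]
  have "run (\<lambda>\<sigma>. \<sigma> = input_store n) count_prog (table_ok m (res (m - 1)) m 0 0 (- m)) (1000 * n ^ 5)"
    by (simp add: count_prog_def)
  then show ?thesis
  proof (rule run_conseq)
    show "\<sigma> (1, []) = (\<Sum>k<n - 1. tail_count (int k + 1 - int (n - 1)) k (n - 1) (int (n - 1) - int k - 1))"
      if "table_ok m (res (m - 1)) m 0 0 (- m) \<sigma>" for \<sigma>
    proof -
      have "nat (m - 1) = l" using lm by simp
      then show ?thesis using that by (simp add: table_ok_def res_def l_def)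
    qed
  qed auto
qed


theorem mainTheorem3:
  shows "(\<forall>n::nat. 1 \<le> n \<longrightarrow>
            card (conn_deg_seqs n) =
              (\<Sum>N\<in>edge_sums n. \<Sum>k\<in>{1..int n - 1}.
                 card (partitions_in_corank (N - k - int n + 1) (k - 1) (int n - 1) (int n - k - 1))))
       \<and> (\<exists>c T S. computes c (\<lambda>n. card (conn_deg_seqs n)) T S \<and>
            (\<lambda>n. real (T n)) \<in> O(\<lambda>n. real n ^ 5) \<and>
            (\<lambda>n. real (S n)) \<in> O(\<lambda>n. real n ^ 5))"
proof (intro conjI allI impI)
  show "card (conn_deg_seqs n) =
      (\<Sum>N\<in>edge_sums n. \<Sum>k\<in>{1..int n - 1}.
        card (partitions_in_corank (N - k - int n + 1) (k - 1) (int n - 1) (int n - k - 1)))"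
    if "1 \<le> n" for n
    using that by (rule card_conn_deg_seqs)
next
  have "\<exists>t M \<sigma>. exec count_prog (input_store n) t M \<sigma> \<and> t \<le> 1000 * n ^ 5
      \<and> \<sigma> (1, []) = int (card (conn_deg_seqs n))" if n: "1 \<le> n" for n
  proof -
    have "int (card (conn_deg_seqs n))
        = (\<Sum>k<n - 1. tail_count (int k + 1 - int (n - 1)) k (n - 1) (int (n - 1) - int k - 1))"
      using card_conn_deg_seqs_tail_count[of "n - 1"] n by simp
    then show ?thesis using run_count_prog[OF n] by (auto simp: run_def)
  qed
  then obtain T M \<sigma> where run: "\<And>n. 1 \<le> n \<Longrightarrow> exec count_prog (input_store n) (T n) (M n) (\<sigma> n)"
      "\<And>n. 1 \<le> n \<Longrightarrow> T n \<le> 1000 * n ^ 5"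
      "\<And>n. 1 \<le> n \<Longrightarrow> \<sigma> n (1, []) = int (card (conn_deg_seqs n))"
    by metis
  have bigo: "(\<lambda>n. real (f n)) \<in> O(\<lambda>n. real n ^ 5)" if f: "\<And>n. 1 \<le> n \<Longrightarrow> f n \<le> 1000 * n ^ 5" for f
  proof (rule bigoI[where c = 1000])
    show "\<forall>\<^sub>F n in sequentially. norm (real (f n)) \<le> 1000 * norm (real n ^ 5)"
      using eventually_ge_at_top[of 1]
    proof eventually_elim
      case (elim n)
      have "real (f n) \<le> real (1000 * n ^ 5)" using f[OF elim] by (simp only: of_nat_le_iff)
      then show ?case by simp
    qed
  qed
  have "computes count_prog (\<lambda>n. card (conn_deg_seqs n)) T (\<lambda>n. card (M n))"
    using run(1,3) unfolding computes_def by blast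
  moreover have "card (M n) \<le> 1000 * n ^ 5" if "1 \<le> n" for n
    using exec_card_le_time[OF run(1)[OF that]] run(2)[OF that] by simp
  ultimately show "\<exists>c T S. computes c (\<lambda>n. card (conn_deg_seqs n)) T S \<and>
      (\<lambda>n. real (T n)) \<in> O(\<lambda>n. real n ^ 5) \<and> (\<lambda>n. real (S n)) \<in> O(\<lambda>n. real n ^ 5)"
    using bigo[of T] bigo[of "\<lambda>n. card (M n)"] run(2) by blast
qed

end
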